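(* Let $G$ be a real reductive Lie group whose complexified Lie algebra satisfies $\mathfrak g_{\mathbb C}\simeq\mathfrak{sl}(2,\mathbb C)$. Then there exist rational functions $c_{\delta\varepsilon}(\lambda',\lambda'';\lambda''')$, $\delta,\varepsilon\in\{+,-\}$, depending only on the parameters $\lambda',\lambda'',\lambda'''$, such that the following holds. Let $\Pi',\Pi'',\Pi'''\in\mathcal M(G)$ have infinitesimal characters $\lambda',\lambda'',\lambda'''$, respectively. Assume that $\lambda',\lambda''\ne0$ and that the primary components of $\Pi'\otimes\mathbb C^2$ and $\Pi''\otimes\mathbb C^2$ are genuine eigenspaces of $\mathfrak Z(\mathfrak g_{\mathbb C})$. Let $T\colon\Pi'\boxtimes\Pi''\to\Pi'''$ be a symmetry breaking operator, and let $\delta,\varepsilon\in\{+,-\}$. Then for every $u\in\Pi'$ and $v\in\Pi''$, $$(T\otimes\operatorname{pr}_{F\to F'})\circ\operatorname{pr}_{\delta\varepsilon}(H(u,v))=c_{\delta\varepsilon}(\lambda',\lambda'';\lambda''')\,T(u\otimes v).$$ Moreover, the functions $c_{\delta\varepsilon}(\lambda',\lambda'';\lambda''')$ are universal in the sense that they depend only on the infinitesimal characters $\lambda',\lambda'',\lambda'''$ and are independent of the choice of the real form $G$ and of the representations $\Pi',\Pi'',\Pi'''$. Explicitly (identifying $\{+,-\}$ with $\{1,-1\}$), they are given by $$c_{\delta\varepsilon}(\lambda',\lambda'';\lambda''')=\frac{(\delta\lambda'+\varepsilon\lambda''+1+\lambda''')(\delta\lambda'+\varepsilon\lambda''+1-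\lambda''')}{8\,\lambda'\lambda''}.$$
   Context: $\mathcal M(G)$ is the category of admissible smooth Fréchet representations of $G$ of finite length and moderate growth. $\mathfrak Z(\mathfrak g_{\mathbb C})$ is the center of $U(\mathfrak g_{\mathbb C})$, generated by the Casimir element $\Omega=H^2+2(XY+YX)$ for a standard $\mathfrak{sl}_2$-triple $\{H,X,Y\}$; infinitesimal character $\lambda\in\mathbb C/\{\pm1\}$ means that $\Omega$ acts by $\lambda^2-1$. $P_\tau(V)$ is the $\tau$-primary component of $V$ (generalized eigenspace of $\mathfrak Z(\mathfrak g_{\mathbb C})$ for infinitesimal character $\tau$). $\Pi'\boxtimes\Pi''$ is the outer tensor product, a representation of $G\times G$; a symmetry breaking operator $T\colon\Pi'\boxtimes\Pi''\to\Pi'''$ is a continuous homomorphism for the diagonal subgroup $G\subset G\times G$. $\mathbb C^2$ is the natural representation of $\mathfrak{sl}(2,\mathbb C)$. For $\delta,\varepsilon\in\{+,-\}\equiv\{1,-1\}$, $$\operatorname{pr}_{\delta\varepsilon}\colon(\Pi'\otimes\mathbb C^2)\boxtimes(\Pi''\otimes\mathbb C^2)\to P_{\lambda'+\delta}(\Pi'\otimes\mathbb C^2)\boxtimes P_{\lambda''+\varepsilon}(\Pi''\otimes\mathbb C^2)$$ is the projection given by the projections onto the primary components of the two factors. Let $\{e_+,e_-\}$ and $\{f_+,f_-\}$ be the standard bases of the two copies of $\mathbb C^2$, let $F=\mathbb C^2\otimes\mathbb C^2\simeq\mathbb C^3\oplus\mathbb C$, and let $F'=\mathbb C(e_+\otimes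 f_--e_-\otimes f_+)\simeq\mathbb C$ be the trivial summand (with $e_+\otimes f_--e_-\otimes f_+\mapsto 1$). The projection $\operatorname{pr}_{F\to F'}\colon F\to F'$ is $(ae_++be_-)\otimes(cf_++df_-)\mapsto\frac12(ad-bc)(e_+\otimes f_--e_-\otimes f_+)$. The map $T\otimes\operatorname{pr}_{F\to F'}$ takes values in $\Pi'''\otimes F'\simeq\Pi'''$. Finally, for $u\in\Pi'$ and $v\in\Pi''$, $$H(u,v):=(u\otimes e_+)\otimes(v\otimes f_-)-(u\otimes e_-)\otimes(v\otimes f_+).$$
   Formalization: The printed explicit formula is wrong by the sign δε; the formal theorem uses the denominator 8(δλ')(ελ''). For Π' trivial and Π''=Π''' with λ''=λ'''=l≠0,1, the printed formula gives c_{++}+c_{+-}=1/l, but this sum must be 1. *)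

theory Defs
  imports "HOL-Analysis.Analysis" "HOL-Algebra.Group" "HOL-Computational_Algebra.Polynomial"
begin

section \<open>Frechet spaces and smooth maps into them\<close>

definition seminorm :: "(complex \<Rightarrow> 'v \<Rightarrow> 'v) \<Rightarrow> ('v::ab_group_add \<Rightarrow> real) \<Rightarrow> bool" where
  "seminorm s q \<longleftrightarrow>
     (\<forall>x y. q (x + y) \<le> q x + q y) \<and> (\<forall>c x. q (s c x) = cmod c * q x)"

definition continuous_seminorm ::
  "(complex \<Rightarrow> 'v \<Rightarrow> 'v) \<Rightarrow> ('v::{t2_space,ab_group_add} \<Rightarrow> real) \<Rightarrow> bool" where
  "continuous_seminorm s q \<longleftrightarrow> seminorm s q \<and> continuous_on UNIV q"

text \<open>The given (Hausdorff) topology is generated by countably many seminorms and is complete.\<close>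

definition frechet_space :: "(complex \<Rightarrow> 'v \<Rightarrow> 'v::{t2_space,ab_group_add}) \<Rightarrow> bool" where
  "frechet_space s \<longleftrightarrow> vector_space s \<and>
     (\<exists>p :: nat \<Rightarrow> 'v \<Rightarrow> real. (\<forall>n. seminorm s (p n)) \<and>
        (\<forall>S. open S \<longleftrightarrow> (\<forall>x\<in>S. \<exists>n. \<exists>e>0. {y. \<forall>i\<le>n. p i (y - x) < e} \<subseteq> S)) \<and>
        (\<forall>X :: nat \<Rightarrow> 'v. (\<forall>n. \<forall>e>0. \<exists>N. \<forall>i\<ge>N. \<forall>j\<ge>N. p n (X i - X j) < e) \<longrightarrow> convergent X))"

definition clinear :: "(complex \<Rightarrow> 'v \<Rightarrow> 'v) \<Rightarrow> (complex \<Rightarrow> 'w \<Rightarrow> 'w)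
    \<Rightarrow> ('v::ab_group_add \<Rightarrow> 'w::ab_group_add) \<Rightarrow> bool" where
  "clinear s s' f \<longleftrightarrow> (\<forall>x y. f (x + y) = f x + f y) \<and> (\<forall>c x. f (s c x) = s' c (f x))"

text \<open>\<open>C_k s k S f\<close>: the map \<open>f\<close> is of class \<open>C^k\<close> on the open set \<open>S\<close>, via iterated partial
  derivatives. The argument \<open>s\<close> is the multiplication by real scalars in the target.\<close>

primrec C_k :: "(real \<Rightarrow> 'w \<Rightarrow> 'w) \<Rightarrow> nat \<Rightarrow> 'm::euclidean_space set
    \<Rightarrow> ('m \<Rightarrow> 'w::{topological_space,ab_group_add}) \<Rightarrow> bool" where
  "C_k s 0 S f = continuous_on S f"
| "C_k s (Suc k) S f = (continuous_on S f \<and>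
     (\<forall>b\<in>Basis. \<exists>D. (\<forall>x\<in>S. ((\<lambda>t. s (inverse t) (f (x + t *\<^sub>R b) - f x)) \<longlongrightarrow> D x) (at 0)) \<and>
        C_k s k S D))"

definition smooth_map :: "(real \<Rightarrow> 'w \<Rightarrow> 'w) \<Rightarrow> 'm::euclidean_space set
    \<Rightarrow> ('m \<Rightarrow> 'w::{topological_space,ab_group_add}) \<Rightarrow> bool" where
  "smooth_map s S f \<longleftrightarrow> (\<forall>k. C_k s k S f)"


section \<open>Lie groups\<close>

text \<open>A group together with an atlas of charts with values in the Euclidean space \<open>'m\<close>.\<close>

record ('g, 'm) charted_group = "'g monoid" +
  charts :: "('g set \<times> ('g \<Rightarrow> 'm)) set"

definition lie_group :: "('g::t2_space, 'm::euclidean_space) charted_group \<Rightarrow> bool" where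
  "lie_group G \<longleftrightarrow> Group.group G \<and> carrier G = UNIV \<and>
     continuous_on UNIV (\<lambda>(x, y). x \<otimes>\<^bsub>G\<^esub> y) \<and> continuous_on UNIV (\<lambda>x. inv\<^bsub>G\<^esub> x) \<and>
     \<Union> (fst ` charts G) = UNIV \<and>
     (\<forall>(U, \<kappa>)\<in>charts G. open U \<and> open (\<kappa> ` U) \<and> homeomorphism U (\<kappa> ` U) \<kappa> (inv_into U \<kappa>)) \<and>
     (\<forall>(U, \<kappa>)\<in>charts G. \<forall>(V, \<psi>)\<in>charts G.
        smooth_map (*\<^sub>R) (\<kappa> ` (U \<inter> V)) (\<lambda>x. \<psi> (inv_into U \<kappa> x))) \<and>
     (\<forall>(U, \<kappa>)\<in>charts G. \<forall>(V, \<psi>)\<in>charts G. \<forall>(W, \<xi>)\<in>charts G.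
        smooth_map (*\<^sub>R) {(x, y). x \<in> \<kappa> ` U \<and> y \<in> \<psi> ` V \<and> inv_into U \<kappa> x \<otimes>\<^bsub>G\<^esub> inv_into V \<psi> y \<in> W}
          (\<lambda>(x, y). \<xi> (inv_into U \<kappa> x \<otimes>\<^bsub>G\<^esub> inv_into V \<psi> y))) \<and>
     (\<forall>(U, \<kappa>)\<in>charts G. \<forall>(V, \<psi>)\<in>charts G.
        smooth_map (*\<^sub>R) {x. x \<in> \<kappa> ` U \<and> inv\<^bsub>G\<^esub> (inv_into U \<kappa> x) \<in> V}
          (\<lambda>x. \<psi> (inv\<^bsub>G\<^esub> (inv_into U \<kappa> x))))"

text \<open>Real reductive groups in the sense of Wallach: \<open>p\<close> is a finite covering of an open subgroup
  of a group of real points, i.e. of a real algebraic subgroup \<open>GR\<close> of \<open>GL(n,R)\<close> that is stable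
  under transposition. As \<open>p\<close> is a homomorphism with finite kernel into a Hausdorff group,
  it is a covering of its image as soon as it is continuous and open onto its image.\<close>

definition real_reductive_group ::
  "('g::t2_space, 'm::euclidean_space) charted_group \<Rightarrow> ('g \<Rightarrow> real^'n^'n) \<Rightarrow> bool" where
  "real_reductive_group G p \<longleftrightarrow> lie_group G \<and>
     continuous_on UNIV p \<and>
     (\<forall>g h. p (g \<otimes>\<^bsub>G\<^esub> h) = p g ** p h) \<and> p \<one>\<^bsub>G\<^esub> = mat 1 \<and>
     finite {g. p g = mat 1} \<and>
     (\<forall>U. open U \<longrightarrow> openin (top_of_set (range p)) (p ` U)) \<and>
     (\<exists>Fs :: (real^'n^'n \<Rightarrow> real) set. \<exists>GR.
        (\<forall>f\<in>Fs. real_polynomial_function f) \<and>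
        GR = {a. invertible a \<and> (\<forall>f\<in>Fs. f a = 0)} \<and>
        mat 1 \<in> GR \<and> (\<forall>a\<in>GR. \<forall>b\<in>GR. a ** b \<in> GR) \<and> (\<forall>a\<in>GR. matrix_inv a \<in> GR) \<and>
        (\<forall>a\<in>GR. transpose a \<in> GR) \<and>
        openin (top_of_set GR) (range p))"

text \<open>The scale of growth on \<open>G\<close>.\<close>

definition group_norm :: "('g, 'm) charted_group \<Rightarrow> ('g \<Rightarrow> real^'n^'n) \<Rightarrow> 'g \<Rightarrow> real" where
  "group_norm G p g = max (norm (p g)) (norm (p (inv\<^bsub>G\<^esub> g)))"

definition maximal_compact :: "('g::t2_space, 'm) charted_group \<Rightarrow> 'g set \<Rightarrow> bool" where
  "maximal_compact G K \<longleftrightarrow> subgroup K G \<and> compact K \<and>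
     (\<forall>K'. subgroup K' G \<and> compact K' \<and> K \<subseteq> K' \<longrightarrow> K' = K)"


section \<open>The Lie algebra\<close>

text \<open>The tangent space at the identity is identified with \<open>'m\<close> by means of a chart there; the
  point of \<open>G\<close> with coordinates \<open>x\<close> relative to the identity is \<open>e_point G x\<close>.\<close>

definition e_chart :: "('g, 'm) charted_group \<Rightarrow> 'g set \<times> ('g \<Rightarrow> 'm)" where
  "e_chart G = (SOME C. C \<in> charts G \<and> \<one>\<^bsub>G\<^esub> \<in> fst C)"

definition e_point :: "('g, 'm::euclidean_space) charted_group \<Rightarrow> 'm \<Rightarrow> 'g" where
  "e_point G x = inv_into (fst (e_chart G)) (snd (e_chart G)) (snd (e_chart G) \<one>\<^bsub>G\<^esub> + x)"

text \<open>In coordinates centred at the identity, the multiplication is \<open>x + y + B(x, y)\<close> plus terms of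
  order at least three, and the Lie bracket is \<open>B(X, Y) - B(Y, X)\<close>.\<close>

definition mult_hessian :: "('g, 'm::euclidean_space) charted_group \<Rightarrow> 'm \<Rightarrow> 'm \<Rightarrow> 'm" where
  "mult_hessian G X Y =
     vector_derivative (\<lambda>s. vector_derivative
       (\<lambda>t. snd (e_chart G) (e_point G (s *\<^sub>R X) \<otimes>\<^bsub>G\<^esub> e_point G (t *\<^sub>R Y))) (at 0)) (at 0)"

definition lie_bracket :: "('g, 'm::euclidean_space) charted_group \<Rightarrow> 'm \<Rightarrow> 'm \<Rightarrow> 'm" where
  "lie_bracket G X Y = mult_hessian G X Y - mult_hessian G Y X"

text \<open>The complexified Lie algebra: the pair \<open>(A, B)\<close> stands for \<open>A + iB\<close>.\<close>

definition cx_scale :: "complex \<Rightarrow> 'm \<times> 'm \<Rightarrow> 'm \<times> 'm::real_vector" where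
  "cx_scale c Z = (Re c *\<^sub>R fst Z - Im c *\<^sub>R snd Z, Re c *\<^sub>R snd Z + Im c *\<^sub>R fst Z)"

definition cx_bracket ::
  "('g, 'm::euclidean_space) charted_group \<Rightarrow> 'm \<times> 'm \<Rightarrow> 'm \<times> 'm \<Rightarrow> 'm \<times> 'm" where
  "cx_bracket G Z W =
     (lie_bracket G (fst Z) (fst W) - lie_bracket G (snd Z) (snd W),
      lie_bracket G (fst Z) (snd W) + lie_bracket G (snd Z) (fst W))"

definition mat_scale :: "complex \<Rightarrow> complex^2^2 \<Rightarrow> complex^2^2" where
  "mat_scale c M = (\<chi> i j. c * M $ i $ j)"

definition sl2_iso ::
  "('g, 'm::euclidean_space) charted_group \<Rightarrow> ('m \<times> 'm \<Rightarrow> complex^2^2) \<Rightarrow> bool" where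
  "sl2_iso G \<phi> \<longleftrightarrow> bij_betw \<phi> UNIV {M. trace M = 0} \<and>
     clinear cx_scale mat_scale \<phi> \<and>
     (\<forall>Z W. \<phi> (cx_bracket G Z W) = \<phi> Z ** \<phi> W - \<phi> W ** \<phi> Z)"

definition sl2_H :: "complex^2^2" where "sl2_H = vector [vector [1, 0], vector [0, -1]]"
definition sl2_X :: "complex^2^2" where "sl2_X = vector [vector [0, 1], vector [0, 0]]"
definition sl2_Y :: "complex^2^2" where "sl2_Y = vector [vector [0, 0], vector [1, 0]]"


section \<open>Representations\<close>

record ('g, 'v) representation =
  smul :: "complex \<Rightarrow> 'v \<Rightarrow> 'v"
  act :: "'g \<Rightarrow> 'v \<Rightarrow> 'v"

definition smooth_frechet_rep :: "('g::t2_space, 'm::euclidean_space) charted_group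
    \<Rightarrow> ('g, 'v::{t2_space,ab_group_add}) representation \<Rightarrow> bool" where
  "smooth_frechet_rep G R \<longleftrightarrow> frechet_space (smul R) \<and>
     (\<forall>g. clinear (smul R) (smul R) (act R g)) \<and>
     (\<forall>g h v. act R (g \<otimes>\<^bsub>G\<^esub> h) v = act R g (act R h v)) \<and>
     (\<forall>v. act R \<one>\<^bsub>G\<^esub> v = v) \<and>
     continuous_on UNIV (\<lambda>(g, v). act R g v) \<and>
     (\<forall>v. \<forall>(U, \<kappa>)\<in>charts G.
        smooth_map (\<lambda>r. smul R (complex_of_real r)) (\<kappa> ` U) (\<lambda>x. act R (inv_into U \<kappa> x) v))"

definition moderate_growth :: "('g, 'm) charted_group \<Rightarrow> ('g \<Rightarrow> real^'n^'n)
    \<Rightarrow> ('g, 'v::{t2_space,ab_group_add}) representation \<Rightarrow> bool" where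
  "moderate_growth G p R \<longleftrightarrow>
     (\<forall>q. continuous_seminorm (smul R) q \<longrightarrow>
        (\<exists>q' d. continuous_seminorm (smul R) q' \<and>
           (\<forall>g v. q (act R g v) \<le> group_norm G p g ^ d * q' v)))"

definition invariant_subspace ::
  "'g set \<Rightarrow> ('g, 'v::ab_group_add) representation \<Rightarrow> 'v set \<Rightarrow> bool" where
  "invariant_subspace K R W \<longleftrightarrow> module.subspace (smul R) W \<and> (\<forall>g\<in>K. act R g ` W \<subseteq> W)"

definition finite_dim :: "('g, 'v::ab_group_add) representation \<Rightarrow> 'v set \<Rightarrow> bool" where
  "finite_dim R W \<longleftrightarrow> (\<exists>B. finite B \<and> W \<subseteq> module.span (smul R) B)"

definition irreducible_subspace ::
  "'g set \<Rightarrow> ('g, 'v::ab_group_add) representation \<Rightarrow> 'v set \<Rightarrow> bool" where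
  "irreducible_subspace K R W \<longleftrightarrow> invariant_subspace K R W \<and> W \<noteq> {0} \<and>
     (\<forall>U. invariant_subspace K R U \<and> U \<subseteq> W \<longrightarrow> U = {0} \<or> U = W)"

definition isotypic_component ::
  "'g set \<Rightarrow> ('g, 'v::ab_group_add) representation \<Rightarrow> 'v set \<Rightarrow> 'v set" where
  "isotypic_component K R W = module.span (smul R) (\<Union>{W'. invariant_subspace K R W' \<and>
     (\<exists>f. clinear (smul R) (smul R) f \<and> bij_betw f W W' \<and>
          (\<forall>g\<in>K. \<forall>w\<in>W. f (act R g w) = act R g (f w)))})"

text \<open>All \<open>K\<close>-types occur with finite multiplicity. (Irreducible representations of \<open>K\<close> that do not
  occur at all need not be mentioned.)\<close>

definition admissible :: "('g::t2_space, 'm) charted_group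
    \<Rightarrow> ('g, 'v::{t2_space,ab_group_add}) representation \<Rightarrow> bool" where
  "admissible G R \<longleftrightarrow> (\<forall>K. maximal_compact G K \<longrightarrow>
     (\<forall>W. irreducible_subspace K R W \<and> finite_dim R W \<longrightarrow>
        finite_dim R (isotypic_component K R W)))"

text \<open>A composition series of closed invariant subspaces; the last clause says that the successive
  quotients are topologically irreducible.\<close>

definition finite_length :: "('g, 'm) charted_group
    \<Rightarrow> ('g, 'v::{t2_space,ab_group_add}) representation \<Rightarrow> bool" where
  "finite_length G R \<longleftrightarrow> (\<exists>n. \<exists>W :: nat \<Rightarrow> 'v set. W 0 = {0} \<and> W n = UNIV \<and>
     (\<forall>i\<le>n. closed (W i) \<and> invariant_subspace (carrier G) R (W i)) \<and>
     (\<forall>i<n. W i \<subset> W (Suc i) \<and>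
        \<not> (\<exists>U. closed U \<and> invariant_subspace (carrier G) R U \<and> W i \<subset> U \<and> U \<subset> W (Suc i))))"

text \<open>The category \<open>M(G)\<close>.\<close>

definition in_category_M :: "('g::t2_space, 'm::euclidean_space) charted_group
    \<Rightarrow> ('g \<Rightarrow> real^'n^'n) \<Rightarrow> ('g, 'v::{t2_space,ab_group_add}) representation \<Rightarrow> bool" where
  "in_category_M G p R \<longleftrightarrow> smooth_frechet_rep G R \<and> admissible G R \<and> finite_length G R \<and>
     moderate_growth G p R"

text \<open>The differential of the orbit map at the identity, in the direction \<open>X\<close>.\<close>

definition lie_act :: "('g, 'm::euclidean_space) charted_group
    \<Rightarrow> ('g, 'v::{t2_space,ab_group_add}) representation \<Rightarrow> 'm \<Rightarrow> 'v \<Rightarrow> 'v" where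
  "lie_act G R X v =
     Lim (at (0::real)) (\<lambda>t. smul R (complex_of_real (inverse t)) (act R (e_point G (t *\<^sub>R X)) v - v))"

definition cx_lie_act :: "('g, 'm::euclidean_space) charted_group
    \<Rightarrow> ('g, 'v::{t2_space,ab_group_add}) representation \<Rightarrow> 'm \<times> 'm \<Rightarrow> 'v \<Rightarrow> 'v" where
  "cx_lie_act G R Z v = lie_act G R (fst Z) v + smul R \<i> (lie_act G R (snd Z) v)"

text \<open>The action of \<open>sl(2,C)\<close> through the isomorphism \<open>\<phi>\<close>.\<close>

definition sl2_act :: "('g, 'm::euclidean_space) charted_group \<Rightarrow> ('m \<times> 'm \<Rightarrow> complex^2^2)
    \<Rightarrow> ('g, 'v::{t2_space,ab_group_add}) representation \<Rightarrow> complex^2^2 \<Rightarrow> 'v \<Rightarrow> 'v" where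
  "sl2_act G \<phi> R M = cx_lie_act G R (inv_into UNIV \<phi> M)"

text \<open>The Casimir element \<open>H^2 + 2(XY + YX)\<close>, which generates the centre of the enveloping algebra,
  under an action \<open>D\<close> of \<open>sl(2,C)\<close>.\<close>

definition casimir ::
  "(complex \<Rightarrow> 'w \<Rightarrow> 'w) \<Rightarrow> (complex^2^2 \<Rightarrow> 'w \<Rightarrow> 'w) \<Rightarrow> 'w \<Rightarrow> 'w::ab_group_add" where
  "casimir s D w = D sl2_H (D sl2_H w) + s 2 (D sl2_X (D sl2_Y w) + D sl2_Y (D sl2_X w))"

definition infinitesimal_character :: "('g, 'm::euclidean_space) charted_group
    \<Rightarrow> ('m \<times> 'm \<Rightarrow> complex^2^2) \<Rightarrow> ('g, 'v::{t2_space,ab_group_add}) representation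
    \<Rightarrow> complex \<Rightarrow> bool" where
  "infinitesimal_character G \<phi> R l \<longleftrightarrow>
     (\<forall>v. casimir (smul R) (sl2_act G \<phi> R) v = smul R (l\<^sup>2 - 1) v)"

text \<open>Primary components, for an operator \<open>\<Omega>\<close> through which the Casimir element acts, and the
  projection onto a primary component along the sum of all the others. The parameter \<open>\<tau>\<close>
  matters only up to sign.\<close>

definition primary_component ::
  "(complex \<Rightarrow> 'w \<Rightarrow> 'w) \<Rightarrow> ('w \<Rightarrow> 'w) \<Rightarrow> complex \<Rightarrow> 'w::ab_group_add set" where
  "primary_component s \<Omega> \<tau> = {w. \<exists>n. ((\<lambda>w. \<Omega> w - s (\<tau>\<^sup>2 - 1) w) ^^ n) w = 0}"

definition primary_projection ::
  "(complex \<Rightarrow> 'w \<Rightarrow> 'w) \<Rightarrow> ('w \<Rightarrow> 'w) \<Rightarrow> complex \<Rightarrow> 'w \<Rightarrow> 'w::ab_group_add" where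
  "primary_projection s \<Omega> \<tau> w =
     (THE y. y \<in> primary_component s \<Omega> \<tau> \<and>
        w - y \<in> module.span s (\<Union>\<sigma>\<in>{\<sigma>. \<sigma>\<^sup>2 \<noteq> \<tau>\<^sup>2}. primary_component s \<Omega> \<sigma>))"

definition primary_components_are_eigenspaces ::
  "(complex \<Rightarrow> 'w \<Rightarrow> 'w) \<Rightarrow> ('w \<Rightarrow> 'w::ab_group_add) \<Rightarrow> bool" where
  "primary_components_are_eigenspaces s \<Omega> \<longleftrightarrow>
     (\<forall>\<tau>. \<forall>w\<in>primary_component s \<Omega> \<tau>. \<Omega> w = s (\<tau>\<^sup>2 - 1) w)"


section \<open>Tensoring with the natural representation\<close>

text \<open>The tensor product of \<open>V\<close> with \<open>C^2\<close> is the space of pairs \<open>'v^2\<close>: the \<open>i\<close>-th entry is the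
  coefficient of the \<open>i\<close>-th standard basis vector.\<close>

definition vec_smul :: "(complex \<Rightarrow> 'v \<Rightarrow> 'v) \<Rightarrow> complex \<Rightarrow> 'v^2 \<Rightarrow> 'v^2" where
  "vec_smul s c x = (\<chi> i. s c (x $ i))"

definition tens :: "(complex \<Rightarrow> 'v \<Rightarrow> 'v) \<Rightarrow> 'v \<Rightarrow> complex^2 \<Rightarrow> 'v^2" where
  "tens s u e = (\<chi> i. s (e $ i) u)"

definition e_plus :: "complex^2" where "e_plus = axis 1 1"
definition e_minus :: "complex^2" where "e_minus = axis 2 1"

text \<open>\<open>M (u \<otimes> e) = Mu \<otimes> e + u \<otimes> Me\<close>.\<close>

definition tens_sl2_act :: "(complex \<Rightarrow> 'v \<Rightarrow> 'v) \<Rightarrow> (complex^2^2 \<Rightarrow> 'v \<Rightarrow> 'v)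
    \<Rightarrow> complex^2^2 \<Rightarrow> 'v^2 \<Rightarrow> 'v::ab_group_add^2" where
  "tens_sl2_act s D M x = (\<chi> i. D M (x $ i) + (\<Sum>j\<in>UNIV. s (M $ i $ j) (x $ j)))"

definition tens_casimir :: "('g, 'm::euclidean_space) charted_group \<Rightarrow> ('m \<times> 'm \<Rightarrow> complex^2^2)
    \<Rightarrow> ('g, 'v::{t2_space,ab_group_add}) representation \<Rightarrow> 'v^2 \<Rightarrow> 'v^2" where
  "tens_casimir G \<phi> R =
     casimir (vec_smul (smul R)) (tens_sl2_act (smul R) (sl2_act G \<phi> R))"

definition tens_projection :: "('g, 'm::euclidean_space) charted_group
    \<Rightarrow> ('m \<times> 'm \<Rightarrow> complex^2^2) \<Rightarrow> ('g, 'v::{t2_space,ab_group_add}) representation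
    \<Rightarrow> complex \<Rightarrow> 'v^2 \<Rightarrow> 'v^2" where
  "tens_projection G \<phi> R \<tau> =
     primary_projection (vec_smul (smul R)) (tens_casimir G \<phi> R) \<tau>"


section \<open>Outer tensor products and symmetry breaking operators\<close>

definition projective_seminorm :: "('v \<Rightarrow> real) \<Rightarrow> ('w \<Rightarrow> real)
    \<Rightarrow> ('v \<Rightarrow> 'w \<Rightarrow> 'e::ab_group_add) \<Rightarrow> 'e \<Rightarrow> real" where
  "projective_seminorm p q t z =
     Inf {(\<Sum>i<m. p (a i) * q (b i)) | (m::nat) a b. z = (\<Sum>i<m. t (a i) (b i))}"

text \<open>\<open>E\<close> with the bilinear map \<open>t\<close> is the completed projective tensor product of two Frechet spaces:
  the algebraic tensor product embeds in \<open>E\<close> as a dense subspace (the clause about independent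
  sets expresses injectivity), and the topology it inherits from \<open>E\<close> is the one given by the
  projective seminorms (it is not finer as \<open>t\<close> is continuous).\<close>

definition completed_tensor_product ::
  "(complex \<Rightarrow> 'v \<Rightarrow> 'v) \<Rightarrow> (complex \<Rightarrow> 'w \<Rightarrow> 'w) \<Rightarrow> (complex \<Rightarrow> 'e \<Rightarrow> 'e)
    \<Rightarrow> ('v::{t2_space,ab_group_add} \<Rightarrow> 'w::{t2_space,ab_group_add} \<Rightarrow> 'e::{t2_space,ab_group_add})
    \<Rightarrow> bool" where
  "completed_tensor_product sV sW sE t \<longleftrightarrow> frechet_space sE \<and>
     (\<forall>w. clinear sV sE (\<lambda>v. t v w)) \<and> (\<forall>v. clinear sW sE (t v)) \<and>
     continuous_on UNIV (\<lambda>(v, w). t v w) \<and>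
     (\<forall>B f. finite B \<and> \<not> module.dependent sW B \<and> (\<Sum>b\<in>B. t (f b) b) = 0 \<longrightarrow> (\<forall>b\<in>B. f b = 0)) \<and>
     closure (module.span sE (range (\<lambda>(v, w). t v w))) = UNIV \<and>
     (\<forall>p q. continuous_seminorm sV p \<and> continuous_seminorm sW q \<longrightarrow>
        (\<exists>r. continuous_seminorm sE r \<and>
           (\<forall>z\<in>module.span sE (range (\<lambda>(v, w). t v w)). projective_seminorm p q t z \<le> r z)))"

text \<open>\<open>E\<close> is the outer tensor product of \<open>R1\<close> and \<open>R2\<close>, a representation of the product group
  (the carrier of \<open>G\<close> is the whole type).\<close>

definition outer_tensor_product ::
  "('g, 'v::{t2_space,ab_group_add}) representation \<Rightarrow> ('g, 'w::{t2_space,ab_group_add}) representation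
    \<Rightarrow> ('g \<times> 'g, 'e::{t2_space,ab_group_add}) representation \<Rightarrow> ('v \<Rightarrow> 'w \<Rightarrow> 'e) \<Rightarrow> bool" where
  "outer_tensor_product R1 R2 E t \<longleftrightarrow> completed_tensor_product (smul R1) (smul R2) (smul E) t \<and>
     (\<forall>g. clinear (smul E) (smul E) (act E g) \<and> continuous_on UNIV (act E g)) \<and>
     (\<forall>g h u v. act E (g, h) (t u v) = t (act R1 g u) (act R2 h v))"

definition symmetry_breaking_operator ::
  "('g \<times> 'g, 'e::{t2_space,ab_group_add}) representation
    \<Rightarrow> ('g, 'v::{t2_space,ab_group_add}) representation \<Rightarrow> ('e \<Rightarrow> 'v) \<Rightarrow> bool" where
  "symmetry_breaking_operator E R T \<longleftrightarrow> clinear (smul E) (smul R) T \<and> continuous_on UNIV T \<and>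
     (\<forall>g z. T (act E (g, g) z) = act R g (T z))"

text \<open>With \<open>E\<close> the outer tensor product of \<open>V\<close> and \<open>W\<close>, that of \<open>'v^2\<close> and \<open>'w^2\<close> is \<open>'e^2^2\<close>: the
  entry \<open>z $ i $ j\<close> is the coefficient of the tensor of the \<open>i\<close>-th basis vector of the first and the
  \<open>j\<close>-th basis vector of the second copy of \<open>C^2\<close>.\<close>

definition outer_tens :: "('v \<Rightarrow> 'w \<Rightarrow> 'e) \<Rightarrow> 'v^2 \<Rightarrow> 'w^2 \<Rightarrow> 'e^2^2" where
  "outer_tens t x y = (\<chi> i j. t (x $ i) (y $ j))"

definition outer_smul :: "(complex \<Rightarrow> 'e \<Rightarrow> 'e) \<Rightarrow> complex \<Rightarrow> 'e^2^2 \<Rightarrow> 'e^2^2" where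
  "outer_smul s c z = (\<chi> i j. s c (z $ i $ j))"

text \<open>\<open>P\<close> is the outer tensor product of the operators \<open>A\<close> and \<open>B\<close>. As the tensors \<open>outer_tens t x y\<close>
  span a dense subspace, \<open>A\<close> and \<open>B\<close> determine \<open>P\<close>.\<close>

definition outer_tensor_map ::
  "(complex \<Rightarrow> 'e \<Rightarrow> 'e) \<Rightarrow> ('v \<Rightarrow> 'w \<Rightarrow> 'e::{t2_space,ab_group_add})
    \<Rightarrow> ('v^2 \<Rightarrow> 'v^2) \<Rightarrow> ('w^2 \<Rightarrow> 'w^2) \<Rightarrow> ('e^2^2 \<Rightarrow> 'e^2^2) \<Rightarrow> bool" where
  "outer_tensor_map s t A B P \<longleftrightarrow> clinear (outer_smul s) (outer_smul s) P \<and> continuous_on UNIV P \<and>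
     (\<forall>x y. P (outer_tens t x y) = outer_tens t (A x) (B y))"

definition H_vector :: "('g, 'v) representation \<Rightarrow> ('g, 'w) representation
    \<Rightarrow> ('v \<Rightarrow> 'w \<Rightarrow> 'e) \<Rightarrow> 'v \<Rightarrow> 'w \<Rightarrow> 'e::ab_group_add^2^2" where
  "H_vector R1 R2 t u v =
     outer_tens t (tens (smul R1) u e_plus) (tens (smul R2) v e_minus) -
     outer_tens t (tens (smul R1) u e_minus) (tens (smul R2) v e_plus)"

text \<open>The projection of \<open>F\<close>, the tensor square of \<open>C^2\<close>, onto its trivial summand, which is identified
  with the complex numbers by means of its generator; a decomposable tensor
  \<open>(a, b) \<otimes> (c, d)\<close> is the matrix with rows \<open>(ac, ad)\<close> and \<open>(bc, bd)\<close>.\<close>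

definition pr_F :: "complex^2^2 \<Rightarrow> complex" where
  "pr_F w = (w $ 1 $ 2 - w $ 2 $ 1) / 2"

definition T_tensor_pr_F :: "(complex \<Rightarrow> 'v \<Rightarrow> 'v) \<Rightarrow> ('e \<Rightarrow> 'v) \<Rightarrow> 'e^2^2 \<Rightarrow> 'v::ab_group_add" where
  "T_tensor_pr_F s T z = (\<Sum>i\<in>UNIV. \<Sum>j\<in>UNIV. s (pr_F (axis i (axis j 1))) (T (z $ i $ j)))"


section \<open>Rational functions of three variables\<close>

definition poly3 :: "complex poly poly poly \<Rightarrow> complex \<Rightarrow> complex \<Rightarrow> complex \<Rightarrow> complex" where
  "poly3 P x y z = poly (poly (poly P [:[:z:]:]) [:y:]) x"

definition rational_function3 :: "(complex \<Rightarrow> complex \<Rightarrow> complex \<Rightarrow> complex) \<Rightarrow> bool" where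
  "rational_function3 f \<longleftrightarrow> (\<exists>P Q. Q \<noteq> 0 \<and>
     (\<forall>x y z. poly3 Q x y z \<noteq> 0 \<longrightarrow> f x y z = poly3 P x y z / poly3 Q x y z))"

end

theory Submission
  imports Defs
begin

text \<open>Write \<open>C = H\<^sup>2 + 2(XY + YX)\<close> for the Casimir element and let \<open>V\<close> be a module on which it acts by
  \<open>\<lambda>\<^sup>2 - 1\<close>. On \<open>V \<otimes> \<complex>\<^sup>2\<close> it acts by \<open>\<lambda>\<^sup>2 + 2 + 2A\<close>, where \<open>A = H \<otimes> H + 2(X \<otimes> Y + Y \<otimes> X)\<close> is the
  polarized Casimir element (\<open>twist\<close>). The commutation relations give \<open>(A + 1)\<^sup>2 = \<lambda>\<^sup>2\<close>
  (\<open>twist_twist\<close>), so for \<open>\<lambda> \<noteq> 0\<close> there are exactly two possible eigenvalues of \<open>C\<close>, namely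
  \<open>(\<lambda> \<plusminus> 1)\<^sup>2 - 1\<close>, and the projection onto the primary component for \<open>\<lambda> + \<delta>\<close> is
  \<open>(A + 1 + \<delta>\<lambda>) / (2\<delta>\<lambda>)\<close> (\<open>tensor_primary_projection\<close>).

  Let \<open>\<lambda>\<^sub>1, \<lambda>\<^sub>2, \<lambda>\<^sub>3\<close> be the three infinitesimal characters. Insert two such projections into the
  contraction with the invariant form on \<open>\<complex>\<^sup>2 \<otimes> \<complex>\<^sup>2\<close>, and put \<open>S(u, v) = T(u \<otimes> v)\<close>. Up to the factor \<open>1 / (8 \<delta>\<lambda>\<^sub>1 \<epsilon>\<lambda>\<^sub>2)\<close>, the result is
  \<open>2 (1 + \<delta>\<lambda>\<^sub>1)(1 + \<epsilon>\<lambda>\<^sub>2) S(u, v)\<close> minus the cross terms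
  \<open>2 S(Hu, Hv) + 4 S(Xu, Yv) + 4 S(Yu, Xv)\<close>. The Leibniz rule for \<open>S\<close> identifies the cross terms
  as the Casimir element of the target applied to \<open>S(u, v)\<close>, minus its action in each of the two
  arguments; all three are scalars, so the cross terms are
  \<open>(\<lambda>\<^sub>3\<^sup>2 - \<lambda>\<^sub>1\<^sup>2 - \<lambda>\<^sub>2\<^sup>2 + 1) S(u, v)\<close> (\<open>cross_terms\<close>). What remains is the identity
  \<open>2 (1 + p)(1 + q) + p\<^sup>2 + q\<^sup>2 - 1 = (1 + p + q)\<^sup>2\<close> for \<open>p = \<delta>\<lambda>\<^sub>1\<close>, \<open>q = \<epsilon>\<lambda>\<^sub>2\<close>.

  The algebra needs the derivatives of a smooth representation to be a representation of
  \<open>sl(2, \<complex>)\<close>. The derivatives are limits of difference quotients in spaces whose topology comes from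
  seminorms, so this rests on a mean value inequality for a single seminorm (\<open>mean_value\<close>); the
  chain rule and the symmetry of second partial derivatives follow from it. Differentiating an orbit
  map twice yields its second differential, which is symmetric, plus the first differential of the
  Hessian of the group multiplication (\<open>lie_act_lie_act\<close>); antisymmetrizing leaves the bracket.\<close>

section \<open>Calculus in spaces topologized by seminorms\<close>

text \<open>Scalars are real, so that the locale covers Frechet spaces as well as the Euclidean space that carries
  the coordinates of the group. Scalar multiplication is a parameter
  since a Frechet space is given here on a type that need not be an instance of
  \<^class>\<open>real_vector\<close>.\<close>

locale seminormed_space = vector_space scale
  for scale :: "real \<Rightarrow> 'w \<Rightarrow> 'w::{t2_space,ab_group_add}" (infixr \<open>*r\<close> 75) +
  fixes p :: "nat \<Rightarrow> 'w \<Rightarrow> real"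
  assumes p_add: "p i (x + y) \<le> p i x + p i y"
    and p_scale: "p i (r *r x) = \<bar>r\<bar> * p i x"
    and open_iff: "open S \<longleftrightarrow> (\<forall>x\<in>S. \<exists>n. \<exists>e>0. {y. \<forall>i\<le>n. p i (y - x) < e} \<subseteq> S)"
begin

lemma p_0 [simp]: "p i 0 = 0"
  using p_scale[of i 0 0] by simp

lemma p_minus: "p i (- x) = p i x"
  using p_scale[of i "-1" x] by simp

lemma p_nonneg: "0 \<le> p i x"
  using p_add[of i x "- x"] p_minus[of i x] by simp

lemma p_diff: "p i (x - y) \<le> p i x + p i y"
  using p_add[of i x "- y"] p_minus[of i y] by simp

lemma p_le_add: "z = x + y \<Longrightarrow> p i z \<le> p i x + p i y"
  using p_add by simp

lemma p_le_diff: "z = x - y \<Longrightarrow> p i z \<le> p i x + p i y"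
  using p_diff by simp

lemma p_triangle: "p i (x - z) \<le> p i (x - y) + p i (y - z)"
  using p_add[of i "x - y" "y - z"] by simp

lemma tendsto_iff_seminorms:
  "(f \<longlongrightarrow> l) F \<longleftrightarrow> (\<forall>i. ((\<lambda>x. p i (f x - l)) \<longlongrightarrow> 0) F)"
proof
  assume f: "(f \<longlongrightarrow> l) F"
  show "\<forall>i. ((\<lambda>x. p i (f x - l)) \<longlongrightarrow> 0) F"
  proof (intro allI tendstoI)
    fix i and e :: real assume "e > 0"
    have "open {y. p i (y - l) < e}"
      unfolding open_iff
    proof
      fix x assume x: "x \<in> {y. p i (y - l) < e}"
      have "{y. \<forall>j\<le>i. p j (y - x) < e - p i (x - l)} \<subseteq> {y. p i (y - l) < e}"
        using p_triangle[of i _ l x] by (auto simp: algebra_simps) (smt (verit) order_refl)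
      then show "\<exists>n. \<exists>d>0. {y. \<forall>j\<le>n. p j (y - x) < d} \<subseteq> {y. p i (y - l) < e}"
        using x by (intro exI[of _ i] exI[of _ "e - p i (x - l)"]) auto
    qed
    then have "\<forall>\<^sub>F x in F. f x \<in> {y. p i (y - l) < e}"
      using f \<open>e > 0\<close> by (intro topological_tendstoD[OF f]) auto
    then show "\<forall>\<^sub>F x in F. dist (p i (f x - l)) 0 < e"
      by (simp add: p_nonneg)
  qed
next
  assume lim: "\<forall>i. ((\<lambda>x. p i (f x - l)) \<longlongrightarrow> 0) F"
  show "(f \<longlongrightarrow> l) F"
  proof (rule topological_tendstoI)
    fix S assume "open S" "l \<in> S"
    then obtain n e where "e > 0" and S: "{y. \<forall>i\<le>n. p i (y - l) < e} \<subseteq> S"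
      unfolding open_iff by blast
    have "\<forall>\<^sub>F x in F. p i (f x - l) < e" for i
      using lim \<open>e > 0\<close> by (auto dest: order_tendstoD(2))
    then have "\<forall>\<^sub>F x in F. \<forall>i\<in>{..n}. p i (f x - l) < e"
      by (intro eventually_ball_finite) auto
    then show "\<forall>\<^sub>F x in F. f x \<in> S"
      by (rule eventually_mono) (use S in auto)
  qed
qed

lemma tendsto_plus:
  fixes f g :: "'a \<Rightarrow> 'w"
  assumes "(f \<longlongrightarrow> a) F" "(g \<longlongrightarrow> b) F"
  shows "((\<lambda>x. f x + g x) \<longlongrightarrow> a + b) F"
  unfolding tendsto_iff_seminorms
proof (intro allI)
  fix i
  have "((\<lambda>x. p i (f x - a) + p i (g x - b)) \<longlongrightarrow> 0 + 0) F"
    using assms unfolding tendsto_iff_seminorms by (intro tendsto_add) auto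
  then have lim: "((\<lambda>x. p i (f x - a) + p i (g x - b)) \<longlongrightarrow> 0) F" by simp
  have le: "p i (f x + g x - (a + b)) \<le> p i (f x - a) + p i (g x - b)" for x
    using p_add[of i "f x - a" "g x - b"] by (simp add: algebra_simps)
  show "((\<lambda>x. p i (f x + g x - (a + b))) \<longlongrightarrow> 0) F"
    by (rule tendsto_sandwich[OF _ _ tendsto_const lim]) (auto simp: le p_nonneg)
qed

lemma tendsto_scale:
  assumes "(r \<longlongrightarrow> a) F" "(g \<longlongrightarrow> b) F"
  shows "((\<lambda>x. r x *r g x) \<longlongrightarrow> a *r b) F"
  unfolding tendsto_iff_seminorms
proof (intro allI)
  fix i
  have "((\<lambda>x. \<bar>r x\<bar> * p i (g x - b) + \<bar>r x - a\<bar> * p i b) \<longlongrightarrow> \<bar>a\<bar> * 0 + \<bar>a - a\<bar> * p i b) F"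
    using assms unfolding tendsto_iff_seminorms[of g] by (intro tendsto_intros) auto
  then have lim: "((\<lambda>x. \<bar>r x\<bar> * p i (g x - b) + \<bar>r x - a\<bar> * p i b) \<longlongrightarrow> 0) F" by simp
  have le: "p i (r x *r g x - a *r b) \<le> \<bar>r x\<bar> * p i (g x - b) + \<bar>r x - a\<bar> * p i b" for x
  proof -
    have "r x *r g x - a *r b = r x *r (g x - b) + (r x - a) *r b"
      by (simp add: scale_right_diff_distrib scale_left_diff_distrib)
    then show ?thesis
      using p_add[of i "r x *r (g x - b)" "(r x - a) *r b"] by (simp add: p_scale)
  qed
  show "((\<lambda>x. p i (r x *r g x - a *r b)) \<longlongrightarrow> 0) F"
    by (rule tendsto_sandwich[OF _ _ tendsto_const lim]) (auto simp: le p_nonneg)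
qed

lemma tendsto_minus:
  fixes f g :: "'a \<Rightarrow> 'w"
  assumes "(f \<longlongrightarrow> a) F" "(g \<longlongrightarrow> b) F"
  shows "((\<lambda>x. f x - g x) \<longlongrightarrow> a - b) F"
  using tendsto_plus[OF assms(1) tendsto_scale[where r = "\<lambda>_. - 1", OF tendsto_const assms(2)]] by simp

lemma tendsto_sums:
  fixes f :: "'b \<Rightarrow> 'a \<Rightarrow> 'w"
  assumes "\<And>b. b \<in> B \<Longrightarrow> (f b \<longlongrightarrow> a b) F"
  shows "((\<lambda>x. \<Sum>b\<in>B. f b x) \<longlongrightarrow> (\<Sum>b\<in>B. a b)) F"
  using assms by (induction B rule: infinite_finite_induct) (auto intro!: tendsto_plus)

text \<open>The derivative of a curve. The target carries no norm, so that \<^const>\<open>has_vector_derivative\<close> does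
  not apply.\<close>

definition has_rate :: "(real \<Rightarrow> 'w) \<Rightarrow> 'w \<Rightarrow> real \<Rightarrow> bool" where
  "has_rate f D x \<longleftrightarrow> ((\<lambda>t. inverse t *r (f (x + t) - f x)) \<longlongrightarrow> D) (at 0)"

lemma has_rate_iff:
  "has_rate f D x \<longleftrightarrow>
    (\<forall>i. \<forall>e>0. \<exists>d>0. \<forall>t. \<bar>t\<bar> < d \<longrightarrow> p i (f (x + t) - f x - t *r D) \<le> e * \<bar>t\<bar>)"
proof -
  have eq: "p i (inverse t *r (f (x + t) - f x) - D) = p i (f (x + t) - f x - t *r D) / \<bar>t\<bar>"
    if "t \<noteq> 0" for i t
  proof -
    have "inverse t *r (f (x + t) - f x) - D = inverse t *r (f (x + t) - f x - t *r D)"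
      using that by (simp add: scale_right_diff_distrib)
    then show ?thesis by (simp add: p_scale divide_inverse mult.commute)
  qed
  show ?thesis
  proof
    assume f: "has_rate f D x"
    show "\<forall>i. \<forall>e>0. \<exists>d>0. \<forall>t. \<bar>t\<bar> < d \<longrightarrow> p i (f (x + t) - f x - t *r D) \<le> e * \<bar>t\<bar>"
    proof (intro allI impI)
      fix i and e :: real assume "e > 0"
      have "((\<lambda>t. p i (inverse t *r (f (x + t) - f x) - D)) \<longlongrightarrow> 0) (at 0)"
        using f unfolding has_rate_def tendsto_iff_seminorms by blast
      then have "\<forall>\<^sub>F t in at 0. p i (inverse t *r (f (x + t) - f x) - D) < e"
        using \<open>e > 0\<close> by (auto dest: order_tendstoD(2))
      then obtain d where "d > 0" and
        d: "\<And>t. t \<noteq> 0 \<Longrightarrow> \<bar>t\<bar> < d \<Longrightarrow> p i (inverse t *r (f (x + t) - f x) - D) < e"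
        unfolding eventually_at by (auto simp: dist_real_def)
      have "p i (f (x + t) - f x - t *r D) \<le> e * \<bar>t\<bar>" if "\<bar>t\<bar> < d" for t
        proof (cases "t = 0")
        case False
        then have "p i (f (x + t) - f x - t *r D) / \<bar>t\<bar> < e" using d[of t] eq[of t i] that by simp
        with False show ?thesis by (simp add: pos_divide_less_eq)
      qed simp
      with \<open>d > 0\<close> show "\<exists>d>0. \<forall>t. \<bar>t\<bar> < d \<longrightarrow> p i (f (x + t) - f x - t *r D) \<le> e * \<bar>t\<bar>"
        by blast
    qed
  next
    assume *: "\<forall>i. \<forall>e>0. \<exists>d>0. \<forall>t. \<bar>t\<bar> < d \<longrightarrow> p i (f (x + t) - f x - t *r D) \<le> e * \<bar>t\<bar>"
    show "has_rate f D x"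
      unfolding has_rate_def tendsto_iff_seminorms
    proof (intro allI tendstoI)
      fix i and e :: real assume "e > 0"
      then obtain d where "d > 0" and
        d: "\<And>t. \<bar>t\<bar> < d \<Longrightarrow> p i (f (x + t) - f x - t *r D) \<le> e / 2 * \<bar>t\<bar>"
        using *[rule_format, of "e / 2"] by auto
      have "p i (inverse t *r (f (x + t) - f x) - D) < e" if "t \<noteq> 0" "\<bar>t\<bar> < d" for t
      proof -
        have "p i (inverse t *r (f (x + t) - f x) - D) \<le> e / 2"
          using d[of t] eq[of t i] that by (simp add: pos_divide_le_eq)
        with \<open>e > 0\<close> show ?thesis by linarith
      qed
      with \<open>d > 0\<close> show
        "\<forall>\<^sub>F t in at 0. dist (p i (inverse t *r (f (x + t) - f x) - D)) 0 < e"
        unfolding eventually_at by (auto simp: dist_real_def p_nonneg)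
    qed
  qed
qed

text \<open>Near any point the increment of \<open>f\<close> differs from \<open>(b - a) c\<close> by at most \<open>e + k\<close> times the length of
  the interval, for every \<open>k > 0\<close>, and such estimates add up along adjacent intervals; bisection makes
  the local estimate global.\<close>

lemma mean_value:
  assumes "a \<le> b"
    and f: "\<And>x. a \<le> x \<Longrightarrow> x \<le> b \<Longrightarrow> has_rate f (f' x) x"
    and f': "\<And>x. a \<le> x \<Longrightarrow> x \<le> b \<Longrightarrow> p i (f' x - c) \<le> e"
  shows "p i (f b - f a - (b - a) *r c) \<le> e * (b - a)"
proof (rule field_le_epsilon)
  fix h :: real assume "h > 0"
  \<comment> \<open>The summand \<open>1\<close> keeps the denominator positive when \<open>a = b\<close>.\<close>
  define k where "k = h / (b - a + 1)"
  have "k > 0" using \<open>h > 0\<close> \<open>a \<le> b\<close> by (simp add: k_def)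
  have "p i (f b - f a - (b - a) *r c) \<le> (e + k) * (b - a)"
    using \<open>a \<le> b\<close>
  proof (induction a b rule: Bolzano)
    case (trans u v w)
    have "f w - f u - (w - u) *r c = (f v - f u - (v - u) *r c) + (f w - f v - (w - v) *r c)"
      by (simp add: scale_left_diff_distrib)
    then have "p i (f w - f u - (w - u) *r c) \<le>
        p i (f v - f u - (v - u) *r c) + p i (f w - f v - (w - v) *r c)"
      by (rule p_le_add)
    with trans have "p i (f w - f u - (w - u) *r c) \<le> (e + k) * (v - u) + (e + k) * (w - v)"
      by linarith
    then show ?case by (simp add: algebra_simps)
  next
    case (local x)
    obtain d where "d > 0" and
      d: "\<And>t. \<bar>t\<bar> < d \<Longrightarrow> p i (f (x + t) - f x - t *r f' x) \<le> k * \<bar>t\<bar>"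
      using f[OF local] \<open>k > 0\<close> unfolding has_rate_iff by blast
    have near: "p i (f (x + t) - f x - t *r c) \<le> (e + k) * \<bar>t\<bar>" if "\<bar>t\<bar> < d" for t
    proof -
      have "f (x + t) - f x - t *r c = (f (x + t) - f x - t *r f' x) + t *r (f' x - c)"
        by (simp add: scale_right_diff_distrib)
      then have "p i (f (x + t) - f x - t *r c) \<le>
          p i (f (x + t) - f x - t *r f' x) + p i (t *r (f' x - c))"
        by (rule p_le_add)
      then have "p i (f (x + t) - f x - t *r c) \<le> k * \<bar>t\<bar> + \<bar>t\<bar> * p i (f' x - c)"
        using d[OF that] by (simp add: p_scale)
      also have "\<dots> \<le> k * \<bar>t\<bar> + \<bar>t\<bar> * e"
        using f'[OF local] by (intro add_left_mono mult_left_mono) auto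
      finally show ?thesis by (simp add: algebra_simps)
    qed
    have "p i (f w - f u - (w - u) *r c) \<le> (e + k) * (w - u)"
      if "u \<le> x" "x \<le> w" "w - u < d" for u w
    proof -
      have "f w - f u - (w - u) *r c =
          (f w - f x - (w - x) *r c) - (f u - f x - (u - x) *r c)"
        by (simp add: scale_left_diff_distrib)
      then have "p i (f w - f u - (w - u) *r c) \<le>
          p i (f w - f x - (w - x) *r c) + p i (f u - f x - (u - x) *r c)"
        by (rule p_le_diff)
      then have "p i (f w - f u - (w - u) *r c) \<le> (e + k) * \<bar>w - x\<bar> + (e + k) * \<bar>u - x\<bar>"
        using near[of "w - x"] near[of "u - x"] that by simp
      then show ?thesis using that by (simp add: algebra_simps)
    qed
    with \<open>d > 0\<close> show ?case by blast
  qed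
  also have "\<dots> = e * (b - a) + k * (b - a)" by (simp add: algebra_simps)
  also have "k * (b - a) \<le> h"
    using \<open>h > 0\<close> \<open>a \<le> b\<close> by (simp add: k_def field_simps)
  finally show "p i (f b - f a - (b - a) *r c) \<le> e * (b - a) + h" by simp
qed

definition has_partial :: "('m::real_normed_vector \<Rightarrow> 'w) \<Rightarrow> 'w \<Rightarrow> 'm \<Rightarrow> 'm \<Rightarrow> bool" where
  "has_partial f D b x \<longleftrightarrow> ((\<lambda>t. inverse t *r (f (x + t *\<^sub>R b) - f x)) \<longlongrightarrow> D) (at 0)"

lemma has_partial_iff_has_rate:
  "has_partial f D b (x + u *\<^sub>R b) \<longleftrightarrow> has_rate (\<lambda>t. f (x + t *\<^sub>R b)) D u"
  unfolding has_partial_def has_rate_def by (simp add: algebra_simps)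

lemma partial_increment:
  assumes f: "\<And>u. \<bar>u\<bar> \<le> \<bar>h\<bar> \<Longrightarrow> has_partial f (D (y + u *\<^sub>R b)) b (y + u *\<^sub>R b)"
    and D: "\<And>u. \<bar>u\<bar> \<le> \<bar>h\<bar> \<Longrightarrow> p i (D (y + u *\<^sub>R b) - c) \<le> e"
  shows "p i (f (y + h *\<^sub>R b) - f y - h *r c) \<le> e * \<bar>h\<bar>"
proof (cases "h \<ge> 0")
  case True
  then show ?thesis
    using mean_value[of 0 h "\<lambda>t. f (y + t *\<^sub>R b)" "\<lambda>u. D (y + u *\<^sub>R b)" i c e] f D
    by (simp add: has_partial_iff_has_rate)
next
  case False
  have "p i (f y - f (y + h *\<^sub>R b) - (- h) *r c) \<le> e * (- h)"
    using mean_value[of h 0 "\<lambda>t. f (y + t *\<^sub>R b)" "\<lambda>u. D (y + u *\<^sub>R b)" i c e] f D False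
    by (simp add: has_partial_iff_has_rate)
  moreover have "f (y + h *\<^sub>R b) - f y - h *r c = - (f y - f (y + h *\<^sub>R b) - (- h) *r c)"
    by simp
  ultimately show ?thesis using False by (metis p_minus abs_of_neg linorder_not_le)
qed

lemma near_value:
  assumes "continuous_on S g" "open S" "x \<in> S" "e > 0"
  obtains d where "d > 0" "ball x d \<subseteq> S" "\<And>y. y \<in> ball x d \<Longrightarrow> p i (g y - g x) \<le> e"
proof -
  have "(g \<longlongrightarrow> g x) (nhds x)"
    using assms by (simp add: continuous_on_eq_continuous_at isCont_def tendsto_at_iff_tendsto_nhds)
  then have "\<forall>\<^sub>F y in nhds x. p i (g y - g x) < e"
    using \<open>e > 0\<close> unfolding tendsto_iff_seminorms by (auto dest: order_tendstoD(2))
  moreover have "\<forall>\<^sub>F y in nhds x. y \<in> S"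
    using assms by (simp add: eventually_nhds_in_open)
  ultimately have "\<forall>\<^sub>F y in nhds x. y \<in> S \<and> p i (g y - g x) < e"
    by (rule eventually_elim2) simp
  then obtain d where "d > 0" "\<And>y. dist y x < d \<Longrightarrow> y \<in> S \<and> p i (g y - g x) < e"
    unfolding eventually_nhds_metric by blast
  then show ?thesis
    by (intro that[of d]) (auto simp: dist_commute less_imp_le)
qed

text \<open>The linear map that the partial derivatives \<open>D b\<close> define at the point \<open>x\<close>, applied to \<open>X\<close>.\<close>

definition differential :: "('m::euclidean_space \<Rightarrow> 'm \<Rightarrow> 'w) \<Rightarrow> 'm \<Rightarrow> 'm \<Rightarrow> 'w" where
  "differential D x X = (\<Sum>b\<in>Basis. (X \<bullet> b) *r D b x)"

lemma differential_linear:
  "differential D x (X + Y) = differential D x X + differential D x Y"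
  "differential D x (X - Y) = differential D x X - differential D x Y"
  "differential D x (r *\<^sub>R X) = r *r differential D x X"
  by (simp_all add: differential_def inner_add_left inner_diff_left scale_left_distrib
      scale_left_diff_distrib sum.distrib sum_subtractf scale_sum_right)

text \<open>Go from \<open>x\<close> to \<open>x + h\<close> along the coordinate axes, one after the other, and compare each increment
  with the value of the partial derivative at \<open>x\<close>: close to \<open>x\<close> they differ by little, because the
  partial derivatives are continuous.\<close>

lemma differential_approximates:
  fixes f :: "'m::euclidean_space \<Rightarrow> 'w"
  assumes "open S" "x \<in> S" "e > 0"
    and f: "\<And>b y. b \<in> Basis \<Longrightarrow> y \<in> S \<Longrightarrow> has_partial f (D b y) b y"
    and D: "\<And>b. b \<in> Basis \<Longrightarrow> continuous_on S (D b)"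
  obtains d where "d > 0"
    "\<And>h. norm h < d \<Longrightarrow> p i (f (x + h) - f x - differential D x h) \<le> e * norm h"
proof -
  define N where "N = real DIM('m)"
  have "N > 0" by (simp add: N_def)
  have "\<exists>d>0. ball x d \<subseteq> S \<and> (\<forall>y\<in>ball x d. p i (D b y - D b x) \<le> e / N)"
    if "b \<in> Basis" for b
    using near_value[OF D[OF that] \<open>open S\<close> \<open>x \<in> S\<close>, of "e / N" i] \<open>e > 0\<close> \<open>N > 0\<close>
    by (metis divide_pos_pos)
  then obtain \<delta> where \<delta>: "\<And>b. b \<in> Basis \<Longrightarrow> \<delta> b > 0 \<and> ball x (\<delta> b) \<subseteq> S \<and>
      (\<forall>y\<in>ball x (\<delta> b). p i (D b y - D b x) \<le> e / N)"
    by metis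
  define \<delta>0 where "\<delta>0 = Min (\<delta> ` Basis)"
  have "\<delta>0 > 0" using \<delta> by (simp add: \<delta>0_def)
  have \<delta>0: "y \<in> S" "p i (D b y - D b x) \<le> e / N" if "b \<in> Basis" "dist x y < \<delta>0" for b y
  proof -
    have "dist x y < \<delta> b"
      using that unfolding \<delta>0_def by (meson Min_le finite_Basis finite_imageI imageI less_le_trans)
    then show "y \<in> S" "p i (D b y - D b x) \<le> e / N" using \<delta>[OF that(1)] by auto
  qed
  have "p i (f (x + h) - f x - differential D x h) \<le> e * norm h" if h: "norm h < \<delta>0 / N" for h
  proof -
    have coord: "\<bar>h \<bullet> b\<bar> \<le> norm h" if "b \<in> Basis" for b using Basis_le_norm[OF that] .
    define part where "part B = (\<Sum>b\<in>B. (h \<bullet> b) *\<^sub>R b)" for B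
    have "p i (f (x + part B) - f x - (\<Sum>b\<in>B. (h \<bullet> b) *r D b x)) \<le> (\<Sum>b\<in>B. e / N * \<bar>h \<bullet> b\<bar>)"
      if "B \<subseteq> Basis" for B
      using finite_subset[OF that finite_Basis] that
    proof (induction B rule: finite_induct)
      case empty
      then show ?case by (simp add: part_def)
    next
      case (insert b B)
      define y where "y = x + part B"
      have dist: "dist x (y + u *\<^sub>R b) < \<delta>0" if u: "\<bar>u\<bar> \<le> \<bar>h \<bullet> b\<bar>" for u
      proof -
        have "norm (part B + u *\<^sub>R b) \<le> (\<Sum>c\<in>B. \<bar>h \<bullet> c\<bar>) + \<bar>u\<bar>"
        proof -
          have "norm (part B) \<le> (\<Sum>c\<in>B. norm ((h \<bullet> c) *\<^sub>R c))"
            unfolding part_def by (rule norm_sum)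
          also have "\<dots> = (\<Sum>c\<in>B. \<bar>h \<bullet> c\<bar>)"
            using insert.prems by (intro sum.cong) auto
          finally show ?thesis
            using norm_triangle_ineq[of "part B" "u *\<^sub>R b"] insert.prems by simp
        qed
        also have "\<dots> \<le> (\<Sum>c\<in>insert b B. \<bar>h \<bullet> c\<bar>)" using u insert.hyps by simp
        also have "\<dots> \<le> (\<Sum>c\<in>(Basis::'m set). \<bar>h \<bullet> c\<bar>)"
          using insert.prems by (intro sum_mono2) auto
        also have "\<dots> \<le> N * norm h"
          unfolding N_def using coord by (intro sum_bounded_above) auto
        also have "\<dots> < \<delta>0" using h \<open>N > 0\<close> by (simp add: field_simps)
        finally have "norm (part B + u *\<^sub>R b) < \<delta>0" .
        then show ?thesis by (simp add: dist_commute[of x]) (simp add: y_def dist_norm add.assoc)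
      qed
      have step: "p i (f (y + (h \<bullet> b) *\<^sub>R b) - f y - (h \<bullet> b) *r D b x) \<le> e / N * \<bar>h \<bullet> b\<bar>"
        using insert.prems dist by (intro partial_increment[where D = "D b"] f \<delta>0) auto
      have "y + (h \<bullet> b) *\<^sub>R b = x + part (insert b B)"
        using insert.hyps by (simp add: y_def part_def algebra_simps)
      then have "f (x + part (insert b B)) - f x - (\<Sum>b\<in>insert b B. (h \<bullet> b) *r D b x) =
          (f (x + part B) - f x - (\<Sum>b\<in>B. (h \<bullet> b) *r D b x)) +
          (f (y + (h \<bullet> b) *\<^sub>R b) - f y - (h \<bullet> b) *r D b x)"
        using insert.hyps by (simp add: y_def[symmetric])
      then have "p i (f (x + part (insert b B)) - f x - (\<Sum>b\<in>insert b B. (h \<bullet> b) *r D b x)) \<le>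
          p i (f (x + part B) - f x - (\<Sum>b\<in>B. (h \<bullet> b) *r D b x)) +
          p i (f (y + (h \<bullet> b) *\<^sub>R b) - f y - (h \<bullet> b) *r D b x)"
        by (rule p_le_add)
      also have "\<dots> \<le> (\<Sum>c\<in>B. e / N * \<bar>h \<bullet> c\<bar>) + e / N * \<bar>h \<bullet> b\<bar>"
        using insert.IH insert.prems step by (intro add_mono) auto
      finally show ?case using insert.hyps by (simp add: add.commute)
    qed
    from this[of Basis] have "p i (f (x + h) - f x - differential D x h) \<le> (\<Sum>b\<in>(Basis::'m set). e / N * \<bar>h \<bullet> b\<bar>)"
      by (simp add: part_def differential_def euclidean_representation)
    also have "\<dots> \<le> N * (e / N * norm h)"
      unfolding N_def using coord \<open>e > 0\<close> by (intro sum_bounded_above mult_left_mono) auto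
    finally show ?thesis using \<open>N > 0\<close> by simp
  qed
  moreover have "\<delta>0 / N > 0" using \<open>\<delta>0 > 0\<close> \<open>N > 0\<close> by simp
  ultimately show ?thesis using that by blast
qed

lemma differential_tendsto:
  fixes \<gamma> :: "'a \<Rightarrow> 'm::euclidean_space"
  assumes "(\<gamma> \<longlongrightarrow> X) F"
  shows "((\<lambda>t. differential D x (\<gamma> t)) \<longlongrightarrow> differential D x X) F"
  unfolding differential_def using assms by (intro tendsto_sums tendsto_scale tendsto_const tendsto_intros)

text \<open>It is needed for products with a curve in the group, which are not straight lines in the chart.\<close>

lemma chain_rule:
  fixes f :: "'m::euclidean_space \<Rightarrow> 'w" and \<gamma> :: "real \<Rightarrow> 'm"
  assumes S: "open S" "\<gamma> 0 \<in> S"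
    and f: "\<And>b y. b \<in> Basis \<Longrightarrow> y \<in> S \<Longrightarrow> has_partial f (D b y) b y"
    and D: "\<And>b. b \<in> Basis \<Longrightarrow> continuous_on S (D b)"
    and \<gamma>: "((\<lambda>t. inverse t *\<^sub>R (\<gamma> t - \<gamma> 0)) \<longlongrightarrow> X) (at 0)"
  shows "((\<lambda>t. inverse t *r (f (\<gamma> t) - f (\<gamma> 0))) \<longlongrightarrow> differential D (\<gamma> 0) X) (at 0)"
proof -
  define x where "x = \<gamma> 0"
  \<comment> \<open>With the difference quotient \<open>q\<close> of the curve, the remainder of \<open>f\<close> at \<open>x + t q(t)\<close> can be divided by \<open>t\<close>.\<close>
  define q where "q t = inverse t *\<^sub>R (\<gamma> t - x)" for t
  have q: "(q \<longlongrightarrow> X) (at 0)" using \<gamma> by (simp add: q_def[abs_def] x_def)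
  have \<gamma>q: "\<gamma> t = x + t *\<^sub>R q t" if "t \<noteq> 0" for t using that by (simp add: q_def)
  have "((\<lambda>t. t *\<^sub>R q t) \<longlongrightarrow> 0 *\<^sub>R X) (at 0)" using q by (intro tendsto_intros)
  then have tq: "((\<lambda>t. t *\<^sub>R q t) \<longlongrightarrow> 0) (at 0)" by simp
  have "((\<lambda>t. inverse t *r (f (\<gamma> t) - f x) - differential D x (q t)) \<longlongrightarrow> 0) (at 0)"
    unfolding tendsto_iff_seminorms
  proof (intro allI tendstoI)
    fix i and e :: real assume "e > 0"
    define e' where "e' = e / (norm X + 2)"
    have "norm X + 2 > 0" by (smt (verit) norm_ge_zero)
    then have "e' > 0" using \<open>e > 0\<close> by (simp add: e'_def)
    obtain d where "d > 0" and
      d: "\<And>h. norm h < d \<Longrightarrow> p i (f (x + h) - f x - differential D x h) \<le> e' * norm h"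
      using differential_approximates[OF S(1) _ \<open>e' > 0\<close> f D, of x] S(2) unfolding x_def by metis
    have "\<forall>\<^sub>F t in at 0. norm (t *\<^sub>R q t) < d"
      using tendstoD[OF tq \<open>d > 0\<close>] by simp
    moreover have "\<forall>\<^sub>F t in at 0. norm (q t) < norm X + 1"
      using tendsto_norm[OF q] by (rule order_tendstoD) simp
    moreover have "\<forall>\<^sub>F t in at (0::real). t \<noteq> 0" by (simp add: eventually_at_filter)
    ultimately show "\<forall>\<^sub>F t in at 0. dist (p i (inverse t *r (f (\<gamma> t) - f x) - differential D x (q t) - 0)) 0 < e"
    proof eventually_elim
      case (elim t)
      have "inverse t *r (f (\<gamma> t) - f x) - differential D x (q t) =
          inverse t *r (f (x + t *\<^sub>R q t) - f x - differential D x (t *\<^sub>R q t))"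
        using elim by (simp add: \<gamma>q scale_right_diff_distrib differential_linear)
      then have "p i (inverse t *r (f (\<gamma> t) - f x) - differential D x (q t)) \<le>
          \<bar>inverse t\<bar> * (e' * norm (t *\<^sub>R q t))"
        using d[of "t *\<^sub>R q t"] elim by (simp add: p_scale mult_left_mono)
      also have "\<dots> = e' * norm (q t)" using elim by (simp add: abs_inverse)
      also have "\<dots> < e' * (norm X + 2)"
        using elim \<open>e' > 0\<close> by (intro mult_strict_left_mono) auto
      also have "\<dots> = e" using \<open>norm X + 2 > 0\<close> by (simp add: e'_def)
      finally show ?case by (simp add: p_nonneg)
    qed
  qed
  from tendsto_plus[OF this differential_tendsto[OF q, of D x]]
  show ?thesis by (simp add: x_def)
qed

lemma has_partial_differential:
  fixes f :: "'m::euclidean_space \<Rightarrow> 'w"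
  assumes "open S" "x \<in> S"
    and "\<And>b y. b \<in> Basis \<Longrightarrow> y \<in> S \<Longrightarrow> has_partial f (D b y) b y"
    and "\<And>b. b \<in> Basis \<Longrightarrow> continuous_on S (D b)"
  shows "has_partial f (differential D x X) X x"
proof -
  have "\<forall>\<^sub>F t in at (0::real). X = inverse t *\<^sub>R (x + t *\<^sub>R X - (x + 0 *\<^sub>R X))"
    by (auto simp: eventually_at_filter)
  then have "((\<lambda>t. inverse t *\<^sub>R (x + t *\<^sub>R X - (x + 0 *\<^sub>R X))) \<longlongrightarrow> X) (at 0)"
    by (rule Lim_transform_eventually[OF tendsto_const])
  from chain_rule[OF assms(1) _ assms(3,4) this] assms(2)
  show ?thesis by (simp add: has_partial_def)
qed

text \<open>The second difference is the increment over \<open>[0, h]\<close> of the function \<open>g\<close>, which is the difference of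
  \<open>f\<close> along two parallel segments. The derivative of \<open>g\<close> is an increment of \<open>D\<close> and hence close to
  \<open>h D'(x)\<close>, so that the mean value inequality applies twice.\<close>

lemma second_difference:
  assumes "e > 0" "open S" "x \<in> S"
    and f: "\<And>y. y \<in> S \<Longrightarrow> has_partial f (D y) b y"
    and D: "\<And>y. y \<in> S \<Longrightarrow> has_partial D (D' y) c y"
    and D': "continuous_on S D'"
  obtains d where "d > 0" "\<And>h. 0 < h \<Longrightarrow> h < d \<Longrightarrow>
    p i (f (x + h *\<^sub>R b + h *\<^sub>R c) - f (x + h *\<^sub>R b) - f (x + h *\<^sub>R c) + f x - (h * h) *r D' x) \<le> e * (h * h)"
proof -
  obtain r where "r > 0" and r: "ball x r \<subseteq> S" "\<And>y. y \<in> ball x r \<Longrightarrow> p i (D' y - D' x) \<le> e"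
    using near_value[OF D' assms(2,3,1)] by blast
  define d where "d = r / (norm b + norm c + 1)"
  have pos: "norm b + norm c + 1 > 0" by (smt (verit) norm_ge_zero)
  have "d > 0" using \<open>r > 0\<close> pos by (simp add: d_def)
  moreover have "p i (f (x + h *\<^sub>R b + h *\<^sub>R c) - f (x + h *\<^sub>R b) - f (x + h *\<^sub>R c) + f x - (h * h) *r D' x)
      \<le> e * (h * h)" if h: "0 < h" "h < d" for h
  proof -
    have inS: "x + u *\<^sub>R b + v *\<^sub>R c \<in> ball x r" if "\<bar>u\<bar> \<le> h" "\<bar>v\<bar> \<le> h" for u v
    proof -
      have "norm (u *\<^sub>R b + v *\<^sub>R c) \<le> \<bar>u\<bar> * norm b + \<bar>v\<bar> * norm c"
        using norm_triangle_ineq[of "u *\<^sub>R b" "v *\<^sub>R c"] by simp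
      also have "\<dots> \<le> h * norm b + h * norm c"
        using that by (intro add_mono mult_right_mono) auto
      also have "\<dots> \<le> h * (norm b + norm c + 1)" using h by (simp add: algebra_simps)
      also have "\<dots> < r" using h pos by (simp add: d_def pos_less_divide_eq)
      finally have "norm (u *\<^sub>R b + v *\<^sub>R c) < r" .
      then show ?thesis by (simp add: dist_commute[of x]) (simp add: dist_norm add.assoc)
    qed
    have D_incr: "p i (D (x + u *\<^sub>R b + h *\<^sub>R c) - D (x + u *\<^sub>R b) - h *r D' x) \<le> e * h"
      if u: "\<bar>u\<bar> \<le> h" for u
      using partial_increment[where f = D and D = D' and y = "x + u *\<^sub>R b" and h = h and b = c
          and i = i and c = "D' x" and e = e] D r inS[OF u] h by (auto simp: subset_iff)
    define g where "g u = f (x + u *\<^sub>R b + h *\<^sub>R c) - f (x + u *\<^sub>R b)" for u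
    have g: "has_rate g (D (x + u *\<^sub>R b + h *\<^sub>R c) - D (x + u *\<^sub>R b)) u" if "\<bar>u\<bar> \<le> h" for u
    proof -
      have 1: "has_partial f (D (x + h *\<^sub>R c + u *\<^sub>R b)) b (x + h *\<^sub>R c + u *\<^sub>R b)"
        using inS[of u h] that r h by (intro f) (auto simp: algebra_simps)
      have 2: "has_partial f (D (x + u *\<^sub>R b)) b (x + u *\<^sub>R b)"
        using inS[of u 0] that r h by (intro f) auto
      from tendsto_minus[OF 1[unfolded has_partial_iff_has_rate has_rate_def]
          2[unfolded has_partial_iff_has_rate has_rate_def]]
      show ?thesis
        unfolding has_rate_def g_def scale_right_diff_distrib by (simp add: algebra_simps)
    qed
    have "p i (g h - g 0 - (h - 0) *r (h *r D' x)) \<le> (e * h) * (h - 0)"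
      using h g D_incr
      by (intro mean_value[where f' = "\<lambda>u. D (x + u *\<^sub>R b + h *\<^sub>R c) - D (x + u *\<^sub>R b)"]) auto
    then show ?thesis by (simp add: g_def algebra_simps)
  qed
  ultimately show ?thesis using that by blast
qed

text \<open>Continuity of \<open>w\<close> at \<open>0\<close> is assumed because the difference quotient of the product splits
  into one term with the value of \<open>w\<close> at \<open>t\<close> and one with the value of \<open>r\<close> at \<open>0\<close>.\<close>

lemma product_rule:
  fixes r :: "real \<Rightarrow> real" and w :: "real \<Rightarrow> 'w"
  assumes r: "((\<lambda>t. inverse t * (r t - r 0)) \<longlongrightarrow> r') (at 0)"
    and w: "((\<lambda>t. inverse t *r (w t - w 0)) \<longlongrightarrow> w') (at 0)"
    and w0: "(w \<longlongrightarrow> w 0) (at 0)"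
  shows "((\<lambda>t. inverse t *r (r t *r w t - r 0 *r w 0)) \<longlongrightarrow> r' *r w 0 + r 0 *r w') (at 0)"
proof -
  have "inverse t *r (r t *r w t - r 0 *r w 0) =
      (inverse t * (r t - r 0)) *r w t + r 0 *r (inverse t *r (w t - w 0))" for t
    by (simp add: algebra_simps)
  then show ?thesis
    using tendsto_plus[OF tendsto_scale[OF r w0] tendsto_scale[OF tendsto_const w, of "r 0"]] by simp
qed

text \<open>Both mixed derivatives are limits of the same second difference, divided by \<open>h\<^sup>2\<close>.\<close>

lemma symmetric_partials:
  assumes S: "open S" "x \<in> S"
    and f: "\<And>y. y \<in> S \<Longrightarrow> has_partial f (D1 y) b y" "\<And>y. y \<in> S \<Longrightarrow> has_partial f (D2 y) c y"
    and D: "\<And>y. y \<in> S \<Longrightarrow> has_partial D1 (D12 y) c y" "\<And>y. y \<in> S \<Longrightarrow> has_partial D2 (D21 y) b y"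
    and cont: "continuous_on S D12" "continuous_on S D21"
  shows "D12 x = D21 x"
proof -
  have "p i (D12 x - D21 x) \<le> 0" for i
  proof (rule field_le_epsilon)
    fix e :: real assume "e > 0"
    then have e2: "e / 2 > 0" by simp
    define \<Delta> where
      "\<Delta> h = f (x + h *\<^sub>R b + h *\<^sub>R c) - f (x + h *\<^sub>R b) - f (x + h *\<^sub>R c) + f x" for h
    obtain d1 where d1: "d1 > 0" "\<And>h. 0 < h \<Longrightarrow> h < d1 \<Longrightarrow>
        p i (\<Delta> h - (h * h) *r D12 x) \<le> e / 2 * (h * h)"
      unfolding \<Delta>_def using second_difference[OF e2 S f(1) D(1) cont(1)] by metis
    obtain d2 where d2: "d2 > 0" "\<And>h. 0 < h \<Longrightarrow> h < d2 \<Longrightarrow>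
        p i (f (x + h *\<^sub>R c + h *\<^sub>R b) - f (x + h *\<^sub>R c) - f (x + h *\<^sub>R b) + f x - (h * h) *r D21 x)
          \<le> e / 2 * (h * h)"
      using second_difference[OF e2 S f(2) D(2) cont(2)] by metis
    have sym: "f (x + h *\<^sub>R c + h *\<^sub>R b) - f (x + h *\<^sub>R c) - f (x + h *\<^sub>R b) + f x = \<Delta> h" for h
      by (simp add: \<Delta>_def algebra_simps)
    define h where "h = min d1 d2 / 2"
    have h: "0 < h" "h < d1" "h < d2" using d1(1) d2(1) by (auto simp: h_def)
    have "(h * h) *r (D12 x - D21 x) = (\<Delta> h - (h * h) *r D21 x) - (\<Delta> h - (h * h) *r D12 x)"
      by (simp add: scale_right_diff_distrib)
    then have "p i ((h * h) *r (D12 x - D21 x)) \<le>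
        p i (\<Delta> h - (h * h) *r D21 x) + p i (\<Delta> h - (h * h) *r D12 x)"
      by (rule p_le_diff)
    then have "(h * h) * p i (D12 x - D21 x) \<le>
        p i (\<Delta> h - (h * h) *r D21 x) + p i (\<Delta> h - (h * h) *r D12 x)"
      by (simp add: p_scale)
    also have "\<dots> \<le> (h * h) * e"
      using d1(2)[OF h(1,2)] d2(2)[OF h(1,3), unfolded sym] by (simp add: mult.commute)
    finally show "p i (D12 x - D21 x) \<le> 0 + e" using h by simp
  qed
  then have "p i (D12 x - D21 x) = 0" for i using p_nonneg[of i "D12 x - D21 x"] by (simp add: antisym)
  then have "((\<lambda>_::nat. D12 x) \<longlongrightarrow> D21 x) sequentially"
    unfolding tendsto_iff_seminorms by simp
  then show ?thesis by (simp add: LIMSEQ_const_iff)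
qed

text \<open>The existential quantifiers in \<^const>\<open>C_k\<close>, resolved up to order two.\<close>

lemma smooth_map_partials:
  assumes "smooth_map scale S f"
  obtains D D2 where "\<And>b x. b \<in> Basis \<Longrightarrow> x \<in> S \<Longrightarrow> has_partial f (D b x) b x"
    "\<And>b. b \<in> Basis \<Longrightarrow> continuous_on S (D b)"
    "\<And>b c x. b \<in> Basis \<Longrightarrow> c \<in> Basis \<Longrightarrow> x \<in> S \<Longrightarrow> has_partial (D b) (D2 b c x) c x"
    "\<And>b c. b \<in> Basis \<Longrightarrow> c \<in> Basis \<Longrightarrow> continuous_on S (D2 b c)"
proof -
  have "C_k scale (Suc (Suc 0)) S f" using assms unfolding smooth_map_def by blast
  then have "\<forall>b\<in>Basis. \<exists>D. (\<forall>x\<in>S. has_partial f (D x) b x) \<and> continuous_on S D \<and>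
      (\<forall>c\<in>Basis. \<exists>D'. (\<forall>x\<in>S. has_partial D (D' x) c x) \<and> continuous_on S D')"
    by (simp add: has_partial_def)
  then obtain D where D: "\<And>b. b \<in> Basis \<Longrightarrow> (\<forall>x\<in>S. has_partial f (D b x) b x) \<and> continuous_on S (D b) \<and>
      (\<forall>c\<in>Basis. \<exists>D'. (\<forall>x\<in>S. has_partial (D b) (D' x) c x) \<and> continuous_on S D')"
    by metis
  then obtain D2 where "\<And>b c. b \<in> Basis \<Longrightarrow> c \<in> Basis \<Longrightarrow>
      (\<forall>x\<in>S. has_partial (D b) (D2 b c x) c x) \<and> continuous_on S (D2 b c)"
    by metis
  with D show ?thesis by (intro that[of D D2]) auto
qed

end

lemma seminormed_space_euclidean:
  "seminormed_space ((*\<^sub>R) :: real \<Rightarrow> 'a::euclidean_space \<Rightarrow> 'a) (\<lambda>_. norm)"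
proof
  have "\<exists>i. i \<le> n" for n :: nat by blast
  then show "open S \<longleftrightarrow> (\<forall>x\<in>S. \<exists>n::nat. \<exists>e>0. {y. \<forall>i\<le>n. norm (y - x) < e} \<subseteq> S)"
    for S :: "'a set"
    by (simp add: open_dist dist_norm subset_iff)
qed (simp_all add: algebra_simps norm_triangle_ineq)

lemma frechet_space_seminorms:
  assumes "frechet_space s"
  obtains p where "seminormed_space (\<lambda>r. s (complex_of_real r)) p"
    "\<And>i c x. p i (s c x) = cmod c * p i x"
proof -
  from assms obtain p where vs: "vector_space s" and p: "\<forall>n. seminorm s (p n)"
    and op: "\<forall>S. open S \<longleftrightarrow> (\<forall>x\<in>S. \<exists>n::nat. \<exists>e>0. {y. \<forall>i\<le>n. p i (y - x) < e} \<subseteq> S)"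
    unfolding frechet_space_def by blast
  interpret vector_space s by (rule vs)
  have "seminormed_space (\<lambda>r. s (complex_of_real r)) p"
  proof
    show "open S \<longleftrightarrow> (\<forall>x\<in>S. \<exists>n. \<exists>e>0. {y. \<forall>i\<le>n. p i (y - x) < e} \<subseteq> S)" for S
      using op by (rule spec)
  qed (use p in \<open>simp_all add: seminorm_def scale_right_distrib scale_left_distrib\<close>)
  moreover have "p i (s c x) = cmod c * p i x" for i c x
    using p by (simp add: seminorm_def)
  ultimately show ?thesis by (rule that)
qed

lemma frechet_space_tendsto_scale:
  assumes "frechet_space s" "(f \<longlongrightarrow> l) F"
  shows "((\<lambda>x. s c (f x)) \<longlongrightarrow> s c l) F"
proof -
  obtain p where "seminormed_space (\<lambda>r. s (complex_of_real r)) p"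
    and p: "\<And>i c x. p i (s c x) = cmod c * p i x"
    using frechet_space_seminorms[OF assms(1)] by blast
  then interpret seminormed_space "\<lambda>r. s (complex_of_real r)" p by simp
  interpret vs: vector_space s using assms(1) by (simp add: frechet_space_def)
  have "((\<lambda>x. cmod c * p i (f x - l)) \<longlongrightarrow> cmod c * 0) F" for i
    using assms(2) unfolding tendsto_iff_seminorms by (intro tendsto_mult tendsto_const) auto
  then show ?thesis
    unfolding tendsto_iff_seminorms by (simp add: p flip: vs.scale_right_diff_distrib)
qed

section \<open>Group multiplication in a chart at the identity\<close>

interpretation eucl: seminormed_space "(*\<^sub>R) :: real \<Rightarrow> 'a::euclidean_space \<Rightarrow> 'a" "\<lambda>_. norm"
  by (rule seminormed_space_euclidean)

lemma tendsto_along: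
  fixes X :: "'m::real_normed_vector"
  shows "((\<lambda>t. x + t *\<^sub>R X) \<longlongrightarrow> x) (at (0::real))"
  by (rule tendsto_eq_intros refl | simp)+

lemma eventually_along:
  fixes X :: "'m::real_normed_vector"
  assumes "open S" "x \<in> S"
  shows "\<forall>\<^sub>F t in at (0::real). x + t *\<^sub>R X \<in> S"
  using tendsto_along assms by (rule topological_tendstoD)

lemma has_vector_derivative_at_0:
  fixes f :: "real \<Rightarrow> 'a::real_normed_vector"
  assumes "((\<lambda>t. inverse t *\<^sub>R (f t - f 0)) \<longlongrightarrow> d) (at 0)"
  shows "(f has_vector_derivative d) (at 0)"
proof -
  have "((\<lambda>t. inverse t *\<^sub>R (f t - f 0) - d) \<longlongrightarrow> 0) (at 0)"
    using tendsto_diff[OF assms tendsto_const[of d]] by simp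
  then have "((\<lambda>t. norm (inverse t *\<^sub>R (f t - f 0) - d)) \<longlongrightarrow> 0) (at 0)"
    by (rule tendsto_norm_zero)
  moreover have "\<forall>\<^sub>F t in at (0::real). norm (inverse t *\<^sub>R (f t - f 0) - d) =
      norm ((f t - f 0 - t *\<^sub>R d) /\<^sub>R norm t)"
  proof -
    have "norm (inverse t *\<^sub>R (f t - f 0) - d) = norm ((f t - f 0 - t *\<^sub>R d) /\<^sub>R norm t)"
      if "t \<noteq> 0" for t
    proof -
      have "inverse t *\<^sub>R (f t - f 0) - d = inverse t *\<^sub>R (f t - f 0 - t *\<^sub>R d)"
        using that by (simp add: scaleR_right_diff_distrib)
      then show ?thesis by simp
    qed
    then show ?thesis by (simp add: eventually_at_filter)
  qed
  ultimately have "((\<lambda>t. norm ((f t - f 0 - t *\<^sub>R d) /\<^sub>R norm t)) \<longlongrightarrow> 0) (at 0)"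
    by (rule Lim_transform_eventually)
  then have "((\<lambda>t. (f t - f 0 - t *\<^sub>R d) /\<^sub>R norm t) \<longlongrightarrow> 0) (at 0)"
    by (rule tendsto_norm_zero_cancel)
  then show ?thesis
    unfolding has_vector_derivative_def has_derivative_at_within
    by (simp add: bounded_linear_scaleR_left)
qed

text \<open>The Lie algebra is defined by means of the chart that \<^const>\<open>e_chart\<close> selects, so only this chart is
  used.\<close>

locale lie_group_at_identity =
  fixes G :: "('g::t2_space, 'm::euclidean_space) charted_group"
  assumes lie: "lie_group G"
begin

abbreviation dom where "dom \<equiv> fst (e_chart G)"
abbreviation chart where "chart \<equiv> snd (e_chart G)"
abbreviation pt where "pt \<equiv> inv_into dom chart"
abbreviation origin where "origin \<equiv> chart \<one>\<^bsub>G\<^esub>"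
abbreviation range_chart where "range_chart \<equiv> chart ` dom"

sublocale group G
  using lie by (simp add: lie_group_def)

lemma carrier_UNIV [simp]: "carrier G = UNIV"
  using lie by (simp add: lie_group_def)

lemma e_chart: "e_chart G \<in> charts G" "\<one>\<^bsub>G\<^esub> \<in> dom"
proof -
  have "\<Union> (fst ` charts G) = UNIV" using lie by (simp add: lie_group_def)
  then have "\<exists>C. C \<in> charts G \<and> \<one>\<^bsub>G\<^esub> \<in> fst C" by blast
  then have "e_chart G \<in> charts G \<and> \<one>\<^bsub>G\<^esub> \<in> dom"
    unfolding e_chart_def by (rule someI_ex)
  then show "e_chart G \<in> charts G" "\<one>\<^bsub>G\<^esub> \<in> dom" by simp_all
qed

lemma chart_props: "open dom" "open range_chart" "homeomorphism dom range_chart chart pt"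
proof -
  have "\<forall>(V, \<psi>)\<in>charts G. open V \<and> open (\<psi> ` V) \<and> homeomorphism V (\<psi> ` V) \<psi> (inv_into V \<psi>)"
    using lie by (simp add: lie_group_def)
  from bspec[OF this e_chart(1)]
  show "open dom" "open range_chart" "homeomorphism dom range_chart chart pt"
    by (simp_all add: case_prod_beta)
qed

lemma pt_chart [simp]: "g \<in> dom \<Longrightarrow> pt (chart g) = g"
  using chart_props(3) by (rule homeomorphism_apply1)

lemma chart_pt [simp]: "x \<in> range_chart \<Longrightarrow> chart (pt x) = x"
  using chart_props(3) by (rule homeomorphism_apply2)

lemma pt_in [simp]: "x \<in> range_chart \<Longrightarrow> pt x \<in> dom"
  by (rule inv_into_into)

lemma origin_in [simp]: "origin \<in> range_chart" "pt origin = \<one>\<^bsub>G\<^esub>"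
  using e_chart(2) by simp_all

lemma e_point_eq: "e_point G x = pt (origin + x)"
  by (simp add: e_point_def)

definition mult_coord :: "'m \<times> 'm \<Rightarrow> 'm" where
  "mult_coord = (\<lambda>(x, y). chart (pt x \<otimes>\<^bsub>G\<^esub> pt y))"

text \<open>Only here does \<open>mult_coord\<close> represent the product: beyond the chart, \<^const>\<open>inv_into\<close> takes default values.\<close>

definition mult_dom :: "('m \<times> 'm) set" where
  "mult_dom = {(x, y). x \<in> range_chart \<and> y \<in> range_chart \<and> pt x \<otimes>\<^bsub>G\<^esub> pt y \<in> dom}"

lemma mult_coord_smooth: "smooth_map (*\<^sub>R) mult_dom mult_coord"
proof -
  have "\<forall>(U, \<kappa>)\<in>charts G. \<forall>(V, \<psi>)\<in>charts G. \<forall>(W, \<xi>)\<in>charts G.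
        smooth_map (*\<^sub>R) {(x, y). x \<in> \<kappa> ` U \<and> y \<in> \<psi> ` V \<and> inv_into U \<kappa> x \<otimes>\<^bsub>G\<^esub> inv_into V \<psi> y \<in> W}
          (\<lambda>(x, y). \<xi> (inv_into U \<kappa> x \<otimes>\<^bsub>G\<^esub> inv_into V \<psi> y))"
    using lie unfolding lie_group_def by blast
  from bspec[OF this e_chart(1)]
  have "\<forall>(V, \<psi>)\<in>charts G. \<forall>(W, \<xi>)\<in>charts G.
        smooth_map (*\<^sub>R) {(x, y). x \<in> range_chart \<and> y \<in> \<psi> ` V \<and> pt x \<otimes>\<^bsub>G\<^esub> inv_into V \<psi> y \<in> W}
          (\<lambda>(x, y). \<xi> (pt x \<otimes>\<^bsub>G\<^esub> inv_into V \<psi> y))"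
    by (simp add: case_prod_beta)
  from bspec[OF this e_chart(1)]
  have "\<forall>(W, \<xi>)\<in>charts G.
        smooth_map (*\<^sub>R) {(x, y). x \<in> range_chart \<and> y \<in> range_chart \<and> pt x \<otimes>\<^bsub>G\<^esub> pt y \<in> W}
          (\<lambda>(x, y). \<xi> (pt x \<otimes>\<^bsub>G\<^esub> pt y))"
    by (simp add: case_prod_beta)
  from bspec[OF this e_chart(1)] show ?thesis
    by (simp add: case_prod_beta mult_coord_def mult_dom_def)
qed

lemma mult_dom_open: "open mult_dom"
proof -
  have pt: "continuous_on range_chart pt"
    using chart_props(3) by (rule homeomorphism_cont2)
  have mult: "continuous_on UNIV (\<lambda>(x, y). x \<otimes>\<^bsub>G\<^esub> y)"
    using lie by (simp add: lie_group_def)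
  have "continuous_on (range_chart \<times> range_chart) (\<lambda>z. (pt (fst z), pt (snd z)))"
    by (intro continuous_on_Pair continuous_on_compose2[OF pt] continuous_on_fst continuous_on_snd
        continuous_on_id) auto
  from continuous_on_compose2[OF mult this]
  have "continuous_on (range_chart \<times> range_chart) (\<lambda>z. pt (fst z) \<otimes>\<^bsub>G\<^esub> pt (snd z))"
    by simp
  then have "open ((\<lambda>z. pt (fst z) \<otimes>\<^bsub>G\<^esub> pt (snd z)) -` dom \<inter> (range_chart \<times> range_chart))"
    using chart_props(1,2) by (simp add: continuous_on_open_vimage open_Times)
  also have "(\<lambda>z. pt (fst z) \<otimes>\<^bsub>G\<^esub> pt (snd z)) -` dom \<inter> (range_chart \<times> range_chart) = mult_dom"
    by (auto simp: mult_dom_def)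
  finally show ?thesis .
qed

lemma mult_dom_origin: "x \<in> range_chart \<Longrightarrow> (x, origin) \<in> mult_dom"
  by (simp add: mult_dom_def)

lemma mult_coord_origin: "x \<in> range_chart \<Longrightarrow> mult_coord (x, origin) = x"
  by (simp add: mult_coord_def)

lemma eventually_mult_dom:
  assumes "x \<in> range_chart"
  shows "\<forall>\<^sub>F t in at (0::real). (x, origin + t *\<^sub>R Y) \<in> mult_dom"
  using eventually_along[OF mult_dom_open mult_dom_origin[OF assms], of "(0, Y)"] by simp

text \<open>In coordinates, \<open>\<psi> Y\<close> is the left invariant vector field with the value \<open>Y\<close> at the identity: the
  derivative at \<open>x\<close> of right multiplication by a curve with velocity \<open>Y\<close>. It is a value of the differential of the
  multiplication, so it can be differentiated once more, and its derivative at the identity is by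
  definition the Hessian from which the bracket is made.\<close>

lemma translation_field:
  obtains \<psi> :: "'m \<Rightarrow> 'm \<Rightarrow> 'm" where
    "\<And>x Y. x \<in> range_chart \<Longrightarrow>
      ((\<lambda>t. inverse t *\<^sub>R (mult_coord (x, origin + t *\<^sub>R Y) - x)) \<longlongrightarrow> \<psi> Y x) (at 0)"
    "\<And>Y. \<psi> Y origin = Y"
    "\<And>X Y. ((\<lambda>t. inverse t *\<^sub>R (\<psi> Y (origin + t *\<^sub>R X) - Y)) \<longlongrightarrow> mult_hessian G X Y) (at 0)"
proof -
  obtain D D2 where
    D: "\<And>b z. b \<in> Basis \<Longrightarrow> z \<in> mult_dom \<Longrightarrow> eucl.has_partial mult_coord (D b z) b z"
      "\<And>b. b \<in> Basis \<Longrightarrow> continuous_on mult_dom (D b)"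
    and D2: "\<And>b c z. b \<in> Basis \<Longrightarrow> c \<in> Basis \<Longrightarrow> z \<in> mult_dom \<Longrightarrow>
        eucl.has_partial (D b) (D2 b c z) c z"
      "\<And>b c. b \<in> Basis \<Longrightarrow> c \<in> Basis \<Longrightarrow> continuous_on mult_dom (D2 b c)"
    by (rule eucl.smooth_map_partials[OF mult_coord_smooth], rule that; assumption)
  define \<psi> where "\<psi> Y x = eucl.differential D (x, origin) (0, Y)" for Y x :: 'm
  have 1: "((\<lambda>t. inverse t *\<^sub>R (mult_coord (x, origin + t *\<^sub>R Y) - x)) \<longlongrightarrow> \<psi> Y x) (at 0)"
    if "x \<in> range_chart" for x Y
    using eucl.has_partial_differential[OF mult_dom_open mult_dom_origin[OF that] D, of "(0, Y)"]
    by (simp add: eucl.has_partial_def \<psi>_def mult_coord_origin that)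
  have 2: "\<psi> Y origin = Y" for Y
  proof (rule tendsto_unique[OF _ 1])
    have "\<forall>\<^sub>F t in at (0::real). origin + t *\<^sub>R Y \<in> range_chart"
      by (rule eventually_along) (auto simp: chart_props)
    moreover have "\<forall>\<^sub>F t in at (0::real). t \<noteq> 0" by (simp add: eventually_at_filter)
    ultimately have
      "\<forall>\<^sub>F t in at 0. Y = inverse t *\<^sub>R (mult_coord (origin, origin + t *\<^sub>R Y) - origin)"
      by eventually_elim (simp add: mult_coord_def)
    then show "((\<lambda>t. inverse t *\<^sub>R (mult_coord (origin, origin + t *\<^sub>R Y) - origin)) \<longlongrightarrow> Y) (at 0)"
      by (rule Lim_transform_eventually[OF tendsto_const])
  qed auto
  have 3: "((\<lambda>t. inverse t *\<^sub>R (\<psi> Y (origin + t *\<^sub>R X) - Y)) \<longlongrightarrow> mult_hessian G X Y) (at 0)" for X Y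
  proof -
    define B where
      "B = (\<Sum>b\<in>Basis. ((0, Y) \<bullet> b) *\<^sub>R eucl.differential (D2 b) (origin, origin) (X, 0))"
    have "((\<lambda>t. inverse t *\<^sub>R (D b (origin + t *\<^sub>R X, origin) - D b (origin, origin))) \<longlongrightarrow>
        eucl.differential (D2 b) (origin, origin) (X, 0)) (at 0)" if "b \<in> Basis" for b
      using eucl.has_partial_differential[OF mult_dom_open mult_dom_origin D2(1)[OF that] D2(2)[OF that],
          of origin "(X, 0)"]
      by (simp add: eucl.has_partial_def)
    then have "((\<lambda>t. \<Sum>b\<in>Basis. ((0, Y) \<bullet> b) *\<^sub>R
        (inverse t *\<^sub>R (D b (origin + t *\<^sub>R X, origin) - D b (origin, origin)))) \<longlongrightarrow> B) (at 0)"
      unfolding B_def by (intro tendsto_sum tendsto_scaleR tendsto_const)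
    also have "(\<lambda>t. \<Sum>b\<in>Basis. ((0, Y) \<bullet> b) *\<^sub>R
        (inverse t *\<^sub>R (D b (origin + t *\<^sub>R X, origin) - D b (origin, origin)))) =
        (\<lambda>t. inverse t *\<^sub>R (\<psi> Y (origin + t *\<^sub>R X) - \<psi> Y origin))"
      by (simp add: \<psi>_def eucl.differential_def scaleR_right_diff_distrib sum_subtractf
          scaleR_sum_right mult.commute)
    finally have B: "((\<lambda>t. inverse t *\<^sub>R (\<psi> Y (origin + t *\<^sub>R X) - Y)) \<longlongrightarrow> B) (at 0)"
      by (simp add: 2)
    have inner: "vector_derivative (\<lambda>t. chart (e_point G (s *\<^sub>R X) \<otimes>\<^bsub>G\<^esub> e_point G (t *\<^sub>R Y))) (at 0)
        = \<psi> Y (origin + s *\<^sub>R X)" if "origin + s *\<^sub>R X \<in> range_chart" for s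
      using 1[OF that, of Y] that
      by (intro vector_derivative_at has_vector_derivative_at_0) (simp add: e_point_eq mult_coord_def)
    have der: "((\<lambda>s. \<psi> Y (origin + s *\<^sub>R X)) has_vector_derivative B) (at 0)"
      using B by (intro has_vector_derivative_at_0) (simp add: 2)
    have ev: "\<forall>\<^sub>F s in nhds (0::real). \<psi> Y (origin + s *\<^sub>R X) =
        vector_derivative (\<lambda>t. chart (e_point G (s *\<^sub>R X) \<otimes>\<^bsub>G\<^esub> e_point G (t *\<^sub>R Y))) (at 0)"
    proof -
      have "\<forall>\<^sub>F s in at (0::real). origin + s *\<^sub>R X \<in> range_chart"
        by (rule eventually_along) (auto simp: chart_props)
      then have "\<forall>\<^sub>F s in nhds (0::real). origin + s *\<^sub>R X \<in> range_chart"
        unfolding eventually_at_filter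
      proof (rule eventually_mono)
        fix s :: real assume "s \<noteq> 0 \<longrightarrow> s \<in> UNIV \<longrightarrow> origin + s *\<^sub>R X \<in> range_chart"
        then show "origin + s *\<^sub>R X \<in> range_chart" by (cases "s = 0") simp_all
      qed
      then show ?thesis by (rule eventually_mono) (simp add: inner)
    qed
    have "((\<lambda>s. vector_derivative
        (\<lambda>t. chart (e_point G (s *\<^sub>R X) \<otimes>\<^bsub>G\<^esub> e_point G (t *\<^sub>R Y))) (at 0)) has_vector_derivative B) (at 0)"
      by (rule has_vector_derivative_cong_ev[THEN iffD1, rotated 2, OF der])
        (rule eventually_mono[OF ev], blast, rule eventually_nhds_x_imp_x[OF ev])
    then have "mult_hessian G X Y = B"
      unfolding mult_hessian_def by (rule vector_derivative_at)
    with B show ?thesis by simp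
  qed
  show ?thesis by (rule that[OF 1 2 3])
qed

end

section \<open>The differentiated representation\<close>

text \<open>The seminorms are a parameter of the locale in order that the calculus above can be used without
  choosing them anew in each proof.\<close>

locale smooth_representation = lie_group_at_identity G
  for G :: "('g::t2_space, 'm::euclidean_space) charted_group" +
  fixes R :: "('g, 'v::{t2_space,ab_group_add}) representation" and p :: "nat \<Rightarrow> 'v \<Rightarrow> real"
  assumes rep: "smooth_frechet_rep G R"
    and seminorms: "seminormed_space (\<lambda>r. smul R (complex_of_real r)) p"
begin

sublocale V: seminormed_space "\<lambda>r. smul R (complex_of_real r)" p
  by (rule seminorms)

lemma frechet: "frechet_space (smul R)"
  using rep by (simp add: smooth_frechet_rep_def)

sublocale C: vector_space "smul R"
  using frechet by (simp add: frechet_space_def)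

lemma act_add: "act R g (u + v) = act R g u + act R g v"
  and act_smul: "act R g (smul R c v) = smul R c (act R g v)"
  and act_mult: "act R (g \<otimes>\<^bsub>G\<^esub> h) v = act R g (act R h v)"
  and act_one [simp]: "act R \<one>\<^bsub>G\<^esub> v = v"
  using rep by (simp_all add: smooth_frechet_rep_def clinear_def)

lemma act_diff: "act R g (u - v) = act R g u - act R g v"
  using act_add[of g "u - v" v] by simp

lemma act_tendsto: "(f \<longlongrightarrow> l) F \<Longrightarrow> ((\<lambda>x. act R g (f x)) \<longlongrightarrow> act R g l) F"
proof -
  assume f: "(f \<longlongrightarrow> l) F"
  have "continuous_on UNIV (\<lambda>(g, v). act R g v)"
    using rep by (simp add: smooth_frechet_rep_def)
  then have "isCont (\<lambda>(g, v). act R g v) (g, l)"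
    by (simp add: continuous_on_eq_continuous_at)
  from isCont_tendsto_compose[OF this tendsto_Pair[OF tendsto_const f]] show ?thesis by simp
qed

definition orbit :: "'v \<Rightarrow> 'm \<Rightarrow> 'v" where
  "orbit v x = act R (pt x) v"

lemma orbit_origin [simp]: "orbit v origin = v"
  by (simp add: orbit_def)

lemma orbit_smooth: "smooth_map (\<lambda>r. smul R (complex_of_real r)) range_chart (orbit v)"
proof -
  have "\<forall>(U, \<kappa>)\<in>charts G. smooth_map (\<lambda>r. smul R (complex_of_real r)) (\<kappa> ` U)
      (\<lambda>x. act R (inv_into U \<kappa> x) v)"
    using rep unfolding smooth_frechet_rep_def by blast
  from bspec[OF this e_chart(1)] show ?thesis
    by (simp add: case_prod_beta orbit_def[abs_def])
qed

lemma orbit_tendsto: "((\<lambda>t. orbit v (origin + t *\<^sub>R X)) \<longlongrightarrow> v) (at (0::real))"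
proof -
  have "C_k (\<lambda>r. smul R (complex_of_real r)) 0 range_chart (orbit v)"
    using orbit_smooth unfolding smooth_map_def by blast
  then have "isCont (orbit v) origin"
    using chart_props(2) origin_in(1) by (simp only: C_k.simps continuous_on_eq_continuous_at)
  from isCont_tendsto_compose[OF this tendsto_along] show ?thesis by simp
qed

text \<open>The action of \<open>X\<close> is the differential of the orbit map at the identity, which makes it linear in \<open>X\<close>.\<close>

lemma orbit_partials:
  obtains D :: "'m \<Rightarrow> 'm \<Rightarrow> 'v" and D2 :: "'m \<Rightarrow> 'm \<Rightarrow> 'm \<Rightarrow> 'v" where
    "\<And>b x. b \<in> Basis \<Longrightarrow> x \<in> range_chart \<Longrightarrow> V.has_partial (orbit v) (D b x) b x"
    "\<And>b. b \<in> Basis \<Longrightarrow> continuous_on range_chart (D b)"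
    "\<And>b c x. b \<in> Basis \<Longrightarrow> c \<in> Basis \<Longrightarrow> x \<in> range_chart \<Longrightarrow> V.has_partial (D b) (D2 b c x) c x"
    "\<And>b c. b \<in> Basis \<Longrightarrow> c \<in> Basis \<Longrightarrow> continuous_on range_chart (D2 b c)"
    "\<And>b c. b \<in> Basis \<Longrightarrow> c \<in> Basis \<Longrightarrow> D2 b c origin = D2 c b origin"
    "\<And>X. V.has_partial (orbit v) (V.differential D origin X) X origin"
    "\<And>X. lie_act G R X v = V.differential D origin X"
proof -
  obtain D D2 where
    D: "\<And>b x. b \<in> Basis \<Longrightarrow> x \<in> range_chart \<Longrightarrow> V.has_partial (orbit v) (D b x) b x"
      "\<And>b. b \<in> Basis \<Longrightarrow> continuous_on range_chart (D b)"
    and D2: "\<And>b c x. b \<in> Basis \<Longrightarrow> c \<in> Basis \<Longrightarrow> x \<in> range_chart \<Longrightarrow>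
        V.has_partial (D b) (D2 b c x) c x"
      "\<And>b c. b \<in> Basis \<Longrightarrow> c \<in> Basis \<Longrightarrow> continuous_on range_chart (D2 b c)"
    by (rule V.smooth_map_partials[OF orbit_smooth[of v]], rule that; assumption)
  have dir: "V.has_partial (orbit v) (V.differential D origin X) X origin" for X
    by (rule V.has_partial_differential[OF chart_props(2) origin_in(1) D])
  then have "lie_act G R X v = V.differential D origin X" for X
    unfolding lie_act_def e_point_eq V.has_partial_def
    by (intro tendsto_Lim) (simp_all add: orbit_def)
  note lie = this
  have sym: "D2 b c origin = D2 c b origin" if "b \<in> Basis" "c \<in> Basis" for b c
    by (rule V.symmetric_partials[OF chart_props(2) origin_in(1) D(1)[OF that(1)] D(1)[OF that(2)]
          D2(1)[OF that] D2(1)[OF that(2,1)] D2(2)[OF that] D2(2)[OF that(2,1)]])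
  show ?thesis by (rule that[OF D D2 sym dir lie])
qed

lemma lie_act_tendsto:
  "((\<lambda>t. smul R (complex_of_real (inverse t)) (orbit v (origin + t *\<^sub>R X) - v)) \<longlongrightarrow> lie_act G R X v) (at 0)"
proof -
  obtain D where "V.has_partial (orbit v) (V.differential D origin X) X origin"
    "lie_act G R X v = V.differential D origin X"
    by (rule orbit_partials[of v], rule that; assumption)
  then show ?thesis by (simp add: V.has_partial_def)
qed

lemma lie_act_unique:
  "((\<lambda>t. smul R (complex_of_real (inverse t)) (orbit v (origin + t *\<^sub>R X) - v)) \<longlongrightarrow> w) (at 0)
    \<Longrightarrow> lie_act G R X v = w"
  using lie_act_tendsto by (rule tendsto_unique[rotated]) auto

lemma lie_act_linear_direction:
  "lie_act G R (X + Y) v = lie_act G R X v + lie_act G R Y v"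
  "lie_act G R (X - Y) v = lie_act G R X v - lie_act G R Y v"
  "lie_act G R (r *\<^sub>R X) v = smul R (complex_of_real r) (lie_act G R X v)"
proof -
  obtain D where "\<And>X. lie_act G R X v = V.differential D origin X"
    by (rule orbit_partials[of v], rule that; assumption)
  then show "lie_act G R (X + Y) v = lie_act G R X v + lie_act G R Y v"
    "lie_act G R (X - Y) v = lie_act G R X v - lie_act G R Y v"
    "lie_act G R (r *\<^sub>R X) v = smul R (complex_of_real r) (lie_act G R X v)"
    by (simp_all add: V.differential_linear)
qed

lemma lie_act_add: "lie_act G R X (u + v) = lie_act G R X u + lie_act G R X v"
  using V.tendsto_plus[OF lie_act_tendsto[of u X] lie_act_tendsto[of v X]]
  by (intro lie_act_unique) (simp add: orbit_def act_add algebra_simps)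

lemma lie_act_smul: "lie_act G R X (smul R c v) = smul R c (lie_act G R X v)"
  using frechet_space_tendsto_scale[OF frechet lie_act_tendsto[of v X], of c]
  by (intro lie_act_unique) (simp add: orbit_def act_smul mult.commute flip: C.scale_right_diff_distrib)

text \<open>By equivariance, the orbit map of \<open>Yv\<close> is at each point \<open>x\<close> the derivative of the orbit map of \<open>v\<close> along
  the left invariant field \<open>\<psi> Y\<close>. Differentiating this along \<open>X\<close> by the product rule gives two terms:
  the derivative of the field, which is the Hessian of the multiplication, and the second differential
  \<open>Q\<close> of the orbit map, whose symmetry is that of the second partial derivatives.\<close>

lemma lie_act_lie_act:
  obtains Q where "\<And>X Y. lie_act G R X (lie_act G R Y v) = lie_act G R (mult_hessian G X Y) v + Q X Y"
    "\<And>X Y. Q X Y = Q Y X"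
proof -
  obtain \<psi> where
    \<psi>: "\<And>x Y. x \<in> range_chart \<Longrightarrow>
        ((\<lambda>t. inverse t *\<^sub>R (mult_coord (x, origin + t *\<^sub>R Y) - x)) \<longlongrightarrow> \<psi> Y x) (at 0)"
      "\<And>Y. \<psi> Y origin = Y"
      "\<And>X Y. ((\<lambda>t. inverse t *\<^sub>R (\<psi> Y (origin + t *\<^sub>R X) - Y)) \<longlongrightarrow> mult_hessian G X Y) (at 0)"
    by (rule translation_field, rule that; assumption)
  obtain D D2 where
    D: "\<And>b x. b \<in> Basis \<Longrightarrow> x \<in> range_chart \<Longrightarrow> V.has_partial (orbit v) (D b x) b x"
      "\<And>b. b \<in> Basis \<Longrightarrow> continuous_on range_chart (D b)"
    and D2: "\<And>b c x. b \<in> Basis \<Longrightarrow> c \<in> Basis \<Longrightarrow> x \<in> range_chart \<Longrightarrow> V.has_partial (D b) (D2 b c x) c x"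
      "\<And>b c. b \<in> Basis \<Longrightarrow> c \<in> Basis \<Longrightarrow> continuous_on range_chart (D2 b c)"
    and sym: "\<And>b c. b \<in> Basis \<Longrightarrow> c \<in> Basis \<Longrightarrow> D2 b c origin = D2 c b origin"
    and lie: "\<And>X. lie_act G R X v = V.differential D origin X"
    by (rule orbit_partials[of v], rule that; assumption)
  have orbit_lie: "orbit (lie_act G R Y v) x = V.differential D x (\<psi> Y x)" if x: "x \<in> range_chart" for x Y
  proof -
    define \<gamma> where "\<gamma> t = mult_coord (x, origin + t *\<^sub>R Y)" for t
    have \<gamma>0: "\<gamma> 0 = x" using x by (simp add: \<gamma>_def mult_coord_origin)
    have "((\<lambda>t. smul R (complex_of_real (inverse t)) (orbit v (\<gamma> t) - orbit v (\<gamma> 0))) \<longlongrightarrow>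
        V.differential D (\<gamma> 0) (\<psi> Y x)) (at 0)"
      by (rule V.chain_rule[OF chart_props(2) _ D]) (use x \<psi>(1)[OF x] in \<open>simp_all add: \<gamma>0\<close>, simp add: \<gamma>_def)
    moreover have "\<forall>\<^sub>F t in at (0::real).
        smul R (complex_of_real (inverse t)) (orbit v (\<gamma> t) - orbit v (\<gamma> 0)) =
        act R (pt x) (smul R (complex_of_real (inverse t)) (orbit v (origin + t *\<^sub>R Y) - v))"
      using eventually_mult_dom[OF x, of Y]
      by eventually_elim
        (simp add: \<gamma>0, simp add: \<gamma>_def orbit_def mult_dom_def mult_coord_def act_mult act_smul act_diff)
    ultimately have "((\<lambda>t. act R (pt x) (smul R (complex_of_real (inverse t))
        (orbit v (origin + t *\<^sub>R Y) - v))) \<longlongrightarrow> V.differential D x (\<psi> Y x)) (at 0)"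
      unfolding \<gamma>0 by (rule Lim_transform_eventually)
    moreover have "((\<lambda>t. act R (pt x) (smul R (complex_of_real (inverse t))
        (orbit v (origin + t *\<^sub>R Y) - v))) \<longlongrightarrow> act R (pt x) (lie_act G R Y v)) (at 0)"
      by (rule act_tendsto[OF lie_act_tendsto])
    ultimately show ?thesis
      unfolding orbit_def by (intro tendsto_unique[of "at (0::real)"]) auto
  qed
  define Q where "Q X Y = (\<Sum>b\<in>Basis. smul R (complex_of_real (Y \<bullet> b))
      (\<Sum>c\<in>Basis. smul R (complex_of_real (X \<bullet> c)) (D2 b c origin)))" for X Y
  have "lie_act G R X (lie_act G R Y v) = lie_act G R (mult_hessian G X Y) v + Q X Y" for X Y
  proof (rule lie_act_unique)
    let ?s = "\<lambda>r. smul R (complex_of_real r)"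
    have "((\<lambda>t. ?s (inverse t) (?s (\<psi> Y (origin + t *\<^sub>R X) \<bullet> b) (D b (origin + t *\<^sub>R X)) -
        ?s (\<psi> Y (origin + 0 *\<^sub>R X) \<bullet> b) (D b (origin + 0 *\<^sub>R X)))) \<longlongrightarrow>
        ?s (mult_hessian G X Y \<bullet> b) (D b (origin + 0 *\<^sub>R X)) +
        ?s (\<psi> Y (origin + 0 *\<^sub>R X) \<bullet> b) (V.differential (D2 b) origin X)) (at 0)"
      if b: "b \<in> Basis" for b
    proof (rule V.product_rule)
      have "((\<lambda>t. (inverse t *\<^sub>R (\<psi> Y (origin + t *\<^sub>R X) - Y)) \<bullet> b) \<longlongrightarrow> mult_hessian G X Y \<bullet> b) (at 0)"
        by (intro tendsto_intros \<psi>(3))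
      then show "((\<lambda>t. inverse t * (\<psi> Y (origin + t *\<^sub>R X) \<bullet> b - \<psi> Y (origin + 0 *\<^sub>R X) \<bullet> b)) \<longlongrightarrow>
          mult_hessian G X Y \<bullet> b) (at 0)"
        by (simp add: \<psi>(2) inner_diff_left)
      show "((\<lambda>t. ?s (inverse t) (D b (origin + t *\<^sub>R X) - D b (origin + 0 *\<^sub>R X))) \<longlongrightarrow>
          V.differential (D2 b) origin X) (at 0)"
        using V.has_partial_differential[OF chart_props(2) origin_in(1) D2(1)[OF b] D2(2)[OF b], of X]
        by (simp add: V.has_partial_def)
      have "isCont (D b) origin"
        using D(2)[OF b] chart_props(2) origin_in(1) by (simp only: continuous_on_eq_continuous_at)
      from isCont_tendsto_compose[OF this tendsto_along]
      show "((\<lambda>t. D b (origin + t *\<^sub>R X)) \<longlongrightarrow> D b (origin + 0 *\<^sub>R X)) (at (0::real))" by simp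
    qed
    then have "((\<lambda>t. \<Sum>b\<in>Basis. ?s (inverse t) (?s (\<psi> Y (origin + t *\<^sub>R X) \<bullet> b) (D b (origin + t *\<^sub>R X)) -
        ?s (Y \<bullet> b) (D b origin))) \<longlongrightarrow>
        (\<Sum>b\<in>Basis. ?s (mult_hessian G X Y \<bullet> b) (D b origin) + ?s (Y \<bullet> b) (V.differential (D2 b) origin X))) (at 0)"
      by (intro V.tendsto_sums) (simp add: \<psi>(2))
    also have "(\<Sum>b\<in>Basis. ?s (mult_hessian G X Y \<bullet> b) (D b origin) + ?s (Y \<bullet> b) (V.differential (D2 b) origin X)) =
        lie_act G R (mult_hessian G X Y) v + Q X Y"
      by (simp add: lie Q_def V.differential_def sum.distrib)
    finally have lim: "((\<lambda>t. \<Sum>b\<in>Basis. ?s (inverse t) (?s (\<psi> Y (origin + t *\<^sub>R X) \<bullet> b) (D b (origin + t *\<^sub>R X)) -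
        ?s (Y \<bullet> b) (D b origin))) \<longlongrightarrow> lie_act G R (mult_hessian G X Y) v + Q X Y) (at 0)" .
    have "\<forall>\<^sub>F t in at (0::real). origin + t *\<^sub>R X \<in> range_chart"
      by (rule eventually_along) (auto simp: chart_props)
    then have "\<forall>\<^sub>F t in at (0::real).
        (\<Sum>b\<in>Basis. ?s (inverse t) (?s (\<psi> Y (origin + t *\<^sub>R X) \<bullet> b) (D b (origin + t *\<^sub>R X)) -
          ?s (Y \<bullet> b) (D b origin))) =
        ?s (inverse t) (orbit (lie_act G R Y v) (origin + t *\<^sub>R X) - lie_act G R Y v)"
      by eventually_elim
        (simp only: orbit_lie, simp only: lie V.differential_def C.scale_sum_right sum_subtractf
          C.scale_right_diff_distrib)
    with lim show "((\<lambda>t. ?s (inverse t) (orbit (lie_act G R Y v) (origin + t *\<^sub>R X) - lie_act G R Y v)) \<longlongrightarrow>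
        lie_act G R (mult_hessian G X Y) v + Q X Y) (at 0)"
      by (rule Lim_transform_eventually)
  qed
  moreover have "Q X Y = Q Y X" for X Y
  proof -
    have "Q X Y = (\<Sum>b\<in>Basis. \<Sum>c\<in>Basis.
        smul R (complex_of_real (Y \<bullet> b) * complex_of_real (X \<bullet> c)) (D2 b c origin))"
      by (simp add: Q_def C.scale_sum_right)
    also have "\<dots> = (\<Sum>c\<in>Basis. \<Sum>b\<in>Basis.
        smul R (complex_of_real (Y \<bullet> b) * complex_of_real (X \<bullet> c)) (D2 b c origin))"
      by (rule sum.swap)
    also have "\<dots> = Q Y X"
      unfolding Q_def C.scale_sum_right
      by (intro sum.cong refl) (simp add: sym mult.commute)
    finally show ?thesis .
  qed
  ultimately show ?thesis by (rule that)
qed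

lemma lie_act_bracket:
  "lie_act G R X (lie_act G R Y v) - lie_act G R Y (lie_act G R X v) = lie_act G R (lie_bracket G X Y) v"
proof -
  obtain Q where "\<And>X Y. lie_act G R X (lie_act G R Y v) = lie_act G R (mult_hessian G X Y) v + Q X Y"
    and "\<And>X Y. Q X Y = Q Y X"
    by (rule lie_act_lie_act[of v], rule that; assumption)
  then show ?thesis
    by (simp add: lie_bracket_def lie_act_linear_direction)
qed

end

section \<open>Complexification and the Leibniz rule\<close>

lemma smooth_representation_exists:
  fixes G :: "('g::t2_space, 'm::euclidean_space) charted_group"
    and R :: "('g, 'v::{t2_space,ab_group_add}) representation"
  assumes "lie_group G" "smooth_frechet_rep G R"
  shows "\<exists>p. smooth_representation G R p"
proof -
  have "frechet_space (smul R)" using assms(2) by (simp add: smooth_frechet_rep_def)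
  then obtain p where "seminormed_space (\<lambda>r. smul R (complex_of_real r)) p"
    by (rule frechet_space_seminorms)
  then have "smooth_representation G R p"
    using assms
    by (intro smooth_representation.intro lie_group_at_identity.intro smooth_representation_axioms.intro)
  then show ?thesis by (rule exI[of _ p])
qed

context smooth_representation begin

lemma cx_lie_act_add: "cx_lie_act G R Z (u + v) = cx_lie_act G R Z u + cx_lie_act G R Z v"
  by (simp add: cx_lie_act_def lie_act_add C.scale_right_distrib algebra_simps)

lemma cx_lie_act_smul: "cx_lie_act G R Z (smul R c v) = smul R c (cx_lie_act G R Z v)"
  by (simp add: cx_lie_act_def lie_act_smul C.scale_right_distrib mult.commute)

lemma cx_lie_act_scale: "cx_lie_act G R (cx_scale c Z) v = smul R c (cx_lie_act G R Z v)"
proof -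
  have c: "complex_of_real (Re c) + \<i> * complex_of_real (Im c) = c"
    by (rule complex_eq[symmetric])
  have "cx_lie_act G R (cx_scale c Z) v =
      smul R (complex_of_real (Re c) + \<i> * complex_of_real (Im c)) (lie_act G R (fst Z) v) +
      smul R (\<i> * (complex_of_real (Re c) + \<i> * complex_of_real (Im c))) (lie_act G R (snd Z) v)"
    by (simp add: cx_lie_act_def cx_scale_def lie_act_linear_direction) (simp add: algebra_simps)
  then show ?thesis
    unfolding c by (simp add: cx_lie_act_def C.scale_right_distrib mult.commute)
qed

lemma cx_lie_act_bracket:
  "cx_lie_act G R (cx_bracket G Z W) v =
    cx_lie_act G R Z (cx_lie_act G R W v) - cx_lie_act G R W (cx_lie_act G R Z v)"
  by (simp add: cx_lie_act_def cx_bracket_def lie_act_linear_direction lie_act_add lie_act_smul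
      lie_act_bracket[symmetric] C.scale_right_distrib C.scale_right_diff_distrib)

end

lemma sl2_brackets:
  "sl2_H ** sl2_X - sl2_X ** sl2_H = mat_scale 2 sl2_X"
  "sl2_H ** sl2_Y - sl2_Y ** sl2_H = mat_scale (- 2) sl2_Y"
  "sl2_X ** sl2_Y - sl2_Y ** sl2_X = sl2_H"
  by (simp_all add: vec_eq_iff forall_2 matrix_matrix_mult_def sum_2 sl2_H_def sl2_X_def sl2_Y_def
      mat_scale_def)

lemma sl2_trace: "trace sl2_H = 0" "trace sl2_X = 0" "trace sl2_Y = 0"
  by (simp_all add: trace_def sum_2 sl2_H_def sl2_X_def sl2_Y_def)

text \<open>The elements of \<open>sl(2, \<complex>)\<close> act through their preimages under \<open>\<phi>\<close>, which exist only for matrices of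
  trace zero.\<close>

lemma sl2_preimage:
  fixes G :: "('g, 'm::euclidean_space) charted_group"
  assumes "sl2_iso G \<phi>"
  shows "\<phi> Z = M \<Longrightarrow> inv_into UNIV \<phi> M = Z" "trace M = 0 \<Longrightarrow> \<phi> (inv_into UNIV \<phi> M) = M"
proof -
  have b: "bij_betw \<phi> UNIV {M. trace M = 0}" using assms by (simp add: sl2_iso_def)
  then show "\<phi> Z = M \<Longrightarrow> inv_into UNIV \<phi> M = Z"
    by (metis UNIV_I bij_betw_def inv_into_f_f)
  show "trace M = 0 \<Longrightarrow> \<phi> (inv_into UNIV \<phi> M) = M"
    using b by (simp add: bij_betw_def f_inv_into_f)
qed

lemma sl2_bracket_preimage:
  fixes G :: "('g, 'm::euclidean_space) charted_group"
  assumes iso: "sl2_iso G \<phi>"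
    and "trace M = 0" "trace N = 0" "trace K = 0" "M ** N - N ** M = mat_scale c K"
  shows "cx_bracket G (inv_into UNIV \<phi> M) (inv_into UNIV \<phi> N) = cx_scale c (inv_into UNIV \<phi> K)"
proof -
  have \<phi>: "\<phi> (cx_bracket G Z W) = \<phi> Z ** \<phi> W - \<phi> W ** \<phi> Z" "\<phi> (cx_scale c Z) = mat_scale c (\<phi> Z)" for Z W c
    using iso unfolding sl2_iso_def clinear_def by blast+
  have "\<phi> (cx_bracket G (inv_into UNIV \<phi> M) (inv_into UNIV \<phi> N)) = \<phi> (cx_scale c (inv_into UNIV \<phi> K))"
    using assms by (simp add: \<phi> sl2_preimage(2)[OF iso])
  then show ?thesis using sl2_preimage(1)[OF iso] by metis
qed

context smooth_representation begin

lemma sl2_act_bracket: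
  assumes "sl2_iso G \<phi>" "trace M = 0" "trace N = 0" "trace K = 0" "M ** N - N ** M = mat_scale c K"
  shows "sl2_act G \<phi> R M (sl2_act G \<phi> R N v) =
    sl2_act G \<phi> R N (sl2_act G \<phi> R M v) + smul R c (sl2_act G \<phi> R K v)"
  using cx_lie_act_bracket[of "inv_into UNIV \<phi> M" "inv_into UNIV \<phi> N" v]
  unfolding sl2_bracket_preimage[OF assms] sl2_act_def cx_lie_act_scale by (simp add: algebra_simps)

end

lemma tendsto_jointly_continuous:
  fixes S :: "'a::t2_space \<Rightarrow> 'b::t2_space \<Rightarrow> 'c::topological_space"
  assumes "continuous_on UNIV (\<lambda>(u, v). S u v)" "(f \<longlongrightarrow> a) F" "(g \<longlongrightarrow> b) F"
  shows "((\<lambda>t. S (f t) (g t)) \<longlongrightarrow> S a b) F"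
proof -
  have "isCont (\<lambda>(u, v). S u v) (a, b)"
    using assms(1) by (simp add: continuous_on_eq_continuous_at)
  from isCont_tendsto_compose[OF this tendsto_Pair[OF assms(2,3)]] show ?thesis by simp
qed

text \<open>A symmetry breaking operator enters only through the bilinear map \<open>S(u, v) = T(u \<otimes> v)\<close>, so that the
  completed tensor product is not referred to from here on.\<close>

locale equivariant_bilinear =
  R1: smooth_representation G R1 p1 + R2: smooth_representation G R2 p2 +
  R3: smooth_representation G R3 p3
  for G :: "('g::t2_space, 'm::euclidean_space) charted_group"
    and R1 :: "('g, 'v1::{t2_space,ab_group_add}) representation" and p1
    and R2 :: "('g, 'v2::{t2_space,ab_group_add}) representation" and p2
    and R3 :: "('g, 'v3::{t2_space,ab_group_add}) representation" and p3 +
  fixes S :: "'v1 \<Rightarrow> 'v2 \<Rightarrow> 'v3"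
  assumes linear1: "clinear (smul R1) (smul R3) (\<lambda>u. S u v)"
    and linear2: "clinear (smul R2) (smul R3) (S u)"
    and continuous: "continuous_on UNIV (\<lambda>(u, v). S u v)"
    and equivariant: "act R3 g (S u v) = S (act R1 g u) (act R2 g v)"
begin

lemma S_linear:
  "S (u + u') v = S u v + S u' v" "S (smul R1 c u) v = smul R3 c (S u v)"
  "S u (v + v') = S u v + S u v'" "S u (smul R2 c v) = smul R3 c (S u v)"
  using linear1 linear2 by (simp_all add: clinear_def)

lemma S_diff: "S (u - u') v = S u v - S u' v" "S u (v - v') = S u v - S u v'"
  using S_linear(1)[of "u - u'" u' v] S_linear(3)[of u "v - v'" v'] by (simp_all add: eq_diff_eq)

text \<open>The product rule for difference quotients. It needs joint continuity of \<open>S\<close>, because both arguments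
  of its first term move with \<open>t\<close>.\<close>

lemma lie_act_leibniz:
  "lie_act G R3 X (S u v) = S (lie_act G R1 X u) v + S u (lie_act G R2 X v)"
proof (rule R3.lie_act_unique)
  let ?c = "\<lambda>t. complex_of_real (inverse t)" and ?x = "\<lambda>t. R1.origin + t *\<^sub>R X"
  have "((\<lambda>t. S (smul R1 (?c t) (R1.orbit u (?x t) - u)) (R2.orbit v (?x t)) +
      S u (smul R2 (?c t) (R2.orbit v (?x t) - v))) \<longlongrightarrow>
      S (lie_act G R1 X u) v + S u (lie_act G R2 X v)) (at 0)"
    by (intro R3.V.tendsto_plus tendsto_jointly_continuous[OF continuous] tendsto_const
        R1.lie_act_tendsto R2.lie_act_tendsto R2.orbit_tendsto)
  also have "(\<lambda>t. S (smul R1 (?c t) (R1.orbit u (?x t) - u)) (R2.orbit v (?x t)) +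
      S u (smul R2 (?c t) (R2.orbit v (?x t) - v))) =
      (\<lambda>t. smul R3 (?c t) (R3.orbit (S u v) (?x t) - S u v))"
    by (simp add: S_linear S_diff R1.orbit_def R2.orbit_def R3.orbit_def equivariant
        R3.C.scale_right_diff_distrib)
  finally show "((\<lambda>t. smul R3 (?c t) (R3.orbit (S u v) (?x t) - S u v)) \<longlongrightarrow>
      S (lie_act G R1 X u) v + S u (lie_act G R2 X v)) (at 0)" .
qed

lemma sl2_act_leibniz:
  "sl2_act G \<phi> R3 M (S u v) = S (sl2_act G \<phi> R1 M u) v + S u (sl2_act G \<phi> R2 M v)"
  by (simp add: sl2_act_def cx_lie_act_def lie_act_leibniz S_linear R3.C.scale_right_distrib algebra_simps)

end

section \<open>The tensor product with the natural representation\<close>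

text \<open>An operator annihilated by \<open>(z - a)(z - b)\<close> splits the space into its two eigenspaces, and the
  projection onto the first is \<open>(\<Omega> - b) / (a - b)\<close>. The primary component for any further eigenvalue
  consists of eigenvectors and hence is zero, as that eigenvalue is no root; so the sum of all
  components but the first is the \<open>b\<close>-eigenspace.\<close>

lemma primary_projection_quadratic:
  assumes "vector_space s" and \<Omega>: "clinear s s \<Omega>"
    and quad: "\<And>w. \<Omega> (\<Omega> w) = s (a + b) (\<Omega> w) - s (a * b) w"
    and a: "a = \<tau>\<^sup>2 - 1" and b: "b = \<sigma>\<^sup>2 - 1" and "a \<noteq> b"
    and eigen: "primary_components_are_eigenspaces s \<Omega>"
  shows "primary_projection s \<Omega> \<tau> w = s (1 / (a - b)) (\<Omega> w - s b w)"
proof -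
  interpret vector_space s by (rule assms(1))
  have \<Omega>_add: "\<Omega> (x + y) = \<Omega> x + \<Omega> y" and \<Omega>_scale: "\<Omega> (s c x) = s c (\<Omega> x)" for c x y
    using \<Omega> by (simp_all add: clinear_def)
  have \<Omega>_diff: "\<Omega> (x - y) = \<Omega> x - \<Omega> y" for x y
    using \<Omega>_add[of "x - y" y] by simp
  have \<Omega>_0: "\<Omega> 0 = 0" using \<Omega>_scale[of 0 0] by simp
  define P where "P = s (1 / (a - b)) (\<Omega> w - s b w)"
  have in_component: "x \<in> primary_component s \<Omega> \<rho>" if "\<Omega> x = s (\<rho>\<^sup>2 - 1) x" for x \<rho>
    unfolding primary_component_def using that by (intro CollectI exI[of _ 1]) simp
  have PE: "\<Omega> P = s a P"
    by (simp add: P_def \<Omega>_scale \<Omega>_diff quad) (simp add: algebra_simps)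
  have "w - P = s (1 / (b - a)) (\<Omega> w - s a w)"
  proof -
    have "w = s (1 / (a - b)) (s a w - s b w)"
      using \<open>a \<noteq> b\<close> by (simp flip: scale_left_diff_distrib)
    moreover have "s (1 / (b - a)) x = - s (1 / (a - b)) x" for x
      using \<open>a \<noteq> b\<close> by (metis scale_minus_left minus_diff_eq minus_divide_right)
    ultimately show ?thesis
      unfolding P_def by (metis (no_types) scale_right_diff_distrib diff_diff_eq2 minus_diff_eq add_diff_cancel_right' add.commute diff_add_cancel)
  qed
  then have QE: "\<Omega> (w - P) = s b (w - P)"
    by (simp add: \<Omega>_scale \<Omega>_diff quad) (simp add: algebra_simps)
  define others where "others = (\<Union>\<rho>\<in>{\<rho>. \<rho>\<^sup>2 \<noteq> \<tau>\<^sup>2}. primary_component s \<Omega> \<rho>)"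
  have "\<sigma>\<^sup>2 \<noteq> \<tau>\<^sup>2" using a b \<open>a \<noteq> b\<close> by auto
  then have "w - P \<in> span others"
    unfolding others_def using QE b by (intro span_base UN_I[of \<sigma>] in_component) auto
  moreover have "P \<in> primary_component s \<Omega> \<tau>" using PE a by (intro in_component) auto
  moreover have "y = P" if y: "y \<in> primary_component s \<Omega> \<tau>" "w - y \<in> span others" for y
  proof -
    have ya: "\<Omega> y = s a y"
      using y(1) eigen a unfolding primary_components_are_eigenspaces_def by blast
    have sub: "subspace {x. \<Omega> x = s b x}"
      by (rule subspaceI) (simp_all add: \<Omega>_add \<Omega>_scale \<Omega>_0 scale_right_distrib mult.commute)
    have "others \<subseteq> {x. \<Omega> x = s b x}"
    proof
      fix x assume "x \<in> others"
      then obtain \<rho> where \<rho>: "\<rho>\<^sup>2 \<noteq> \<tau>\<^sup>2" "x \<in> primary_component s \<Omega> \<rho>" by (auto simp: others_def)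
      define c where "c = \<rho>\<^sup>2 - 1"
      have "c \<noteq> a" using \<rho>(1) by (simp add: c_def a)
      have xc: "\<Omega> x = s c x"
        using \<rho>(2) eigen unfolding primary_components_are_eigenspaces_def c_def by blast
      have "s ((c - a) * (c - b)) x = \<Omega> (\<Omega> x) - (s (a + b) (\<Omega> x) - s (a * b) x)"
        by (simp add: xc \<Omega>_scale) (simp add: algebra_simps)
      also have "\<dots> = 0" using quad by simp
      finally have "c = b \<or> x = 0" using \<open>c \<noteq> a\<close> by simp
      then show "x \<in> {x. \<Omega> x = s b x}" using xc \<Omega>_0 by auto
    qed
    then have "span others \<subseteq> {x. \<Omega> x = s b x}" using sub by (rule span_minimal)
    then have yb: "\<Omega> (w - y) = s b (w - y)" using y(2) by blast
    have "s a (y - P) = \<Omega> (y - P)" by (simp add: \<Omega>_diff ya PE scale_right_diff_distrib)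
    also have "\<dots> = \<Omega> ((w - P) - (w - y))" by simp
    also have "\<dots> = s b ((w - P) - (w - y))"
      unfolding \<Omega>_diff[of "w - P"] QE yb by (simp only: scale_right_diff_distrib)
    also have "\<dots> = s b (y - P)" by simp
    finally have "s (a - b) (y - P) = 0" by (simp add: scale_left_diff_distrib)
    then show "y = P" using \<open>a \<noteq> b\<close> by simp
  qed
  ultimately show ?thesis
    unfolding primary_projection_def P_def[symmetric] others_def[symmetric] by (intro the_equality) blast+
qed

text \<open>The relations are oriented so that rewriting with them moves \<open>H\<close> to the right of \<open>X\<close> and \<open>Y\<close>, and \<open>X\<close> to the
  right of \<open>Y\<close>. Together with the expression of \<open>H\<^sup>2\<close> that the infinitesimal character \<open>l\<close> provides
  (\<open>HH\<close> below), this brings the products of two operators into a normal form.\<close>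

locale sl2_module = vector_space s
  for s :: "complex \<Rightarrow> 'v \<Rightarrow> 'v::ab_group_add" +
  fixes D :: "complex^2^2 \<Rightarrow> 'v \<Rightarrow> 'v" and l :: complex
  assumes D_add: "D M (u + v) = D M u + D M v"
    and D_scale: "D M (s c v) = s c (D M v)"
    and HX: "D sl2_H (D sl2_X v) = D sl2_X (D sl2_H v) + s 2 (D sl2_X v)"
    and HY: "D sl2_H (D sl2_Y v) = D sl2_Y (D sl2_H v) - s 2 (D sl2_Y v)"
    and XY: "D sl2_X (D sl2_Y v) = D sl2_Y (D sl2_X v) + D sl2_H v"
    and casimir: "casimir s D v = s (l\<^sup>2 - 1) v"
begin

abbreviation "H \<equiv> D sl2_H"
abbreviation "X \<equiv> D sl2_X"
abbreviation "Y \<equiv> D sl2_Y"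

lemma D_diff: "D M (u - v) = D M u - D M v"
  using D_add[of M "u - v" v] by simp

lemma scale_2: "s 2 v = v + v"
  using scale_left_distrib[of 1 1 v] by simp

lemma HH: "H (H v) = s (l\<^sup>2 - 1) v - (s 2 (H v) + s 2 (s 2 (Y (X v))))"
  using casimir[of v] by (simp add: casimir_def XY scale_2 eq_diff_eq algebra_simps)

lemma vector_space_pairs: "vector_space (vec_smul s)"
  by unfold_locales (simp_all add: vec_smul_def vec_eq_iff scale_right_distrib scale_left_distrib)

text \<open>The operator \<open>H \<otimes> H + 2(X \<otimes> Y + Y \<otimes> X)\<close> on \<open>V \<otimes> \<complex>\<^sup>2\<close>, the mixed part of the Casimir element.\<close>

definition twist :: "'v^2 \<Rightarrow> 'v^2" where
  "twist x = (\<chi> i. if i = 1 then H (x $ 1) + s 2 (Y (x $ 2)) else s 2 (X (x $ 1)) - H (x $ 2))"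

lemma twist_nth [simp]:
  "twist x $ 1 = H (x $ 1) + s 2 (Y (x $ 2))"
  "twist x $ 2 = s 2 (X (x $ 1)) - H (x $ 2)"
  by (simp_all add: twist_def)

lemma twist_linear: "clinear (vec_smul s) (vec_smul s) twist"
  by (simp add: clinear_def vec_eq_iff forall_2 vec_smul_def D_add D_scale algebra_simps)

text \<open>Equivalently, \<open>(twist + 1)\<^sup>2 = l\<^sup>2\<close>.\<close>

lemma twist_twist: "twist (twist x) = vec_smul s (l\<^sup>2 - 1) x - vec_smul s 2 (twist x)"
  by (simp add: vec_eq_iff forall_2 vec_smul_def D_add D_scale D_diff HX HY XY HH scale_2)

text \<open>The constant is \<open>(l\<^sup>2 - 1) + 3\<close>, because the Casimir element acts on \<open>\<complex>\<^sup>2\<close> by \<open>3\<close>.\<close>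

lemma tensor_casimir:
  "casimir (vec_smul s) (tens_sl2_act s D) x = vec_smul s (l\<^sup>2 + 2) x + vec_smul s 2 (twist x)"
proof -
  have act: "tens_sl2_act s D sl2_H x $ 1 = H (x $ 1) + x $ 1"
    "tens_sl2_act s D sl2_H x $ 2 = H (x $ 2) - x $ 2"
    "tens_sl2_act s D sl2_X x $ 1 = X (x $ 1) + x $ 2"
    "tens_sl2_act s D sl2_X x $ 2 = X (x $ 2)"
    "tens_sl2_act s D sl2_Y x $ 1 = Y (x $ 1)"
    "tens_sl2_act s D sl2_Y x $ 2 = Y (x $ 2) + x $ 1" for x
    by (simp_all add: tens_sl2_act_def sum_2 sl2_H_def sl2_X_def sl2_Y_def)
  have l: "s (l\<^sup>2 + 2) v = s (l\<^sup>2 - 1) v + v + v + v" for v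
  proof -
    have "s (l\<^sup>2 + 2) v = s ((l\<^sup>2 - 1) + 1 + 1 + 1) v" by simp
    then show ?thesis by (simp only: scale_left_distrib scale_one)
  qed
  show ?thesis
    by (simp only: vec_eq_iff forall_2 vector_add_component casimir_def vec_smul_def vec_lambda_beta
        act twist_nth l D_add D_diff XY HX HY HH scale_2)
      (simp add: algebra_simps)
qed

text \<open>By \<open>twist_twist\<close> the Casimir element satisfies a quadratic equation with the roots
  \<open>(l + \<delta>)\<^sup>2 - 1\<close> and \<open>(l - \<delta>)\<^sup>2 - 1\<close>. These differ by \<open>4 \<delta> l\<close>, which is where \<open>l \<noteq> 0\<close> is needed.\<close>

lemma tensor_primary_projection:
  assumes "l \<noteq> 0" "\<delta> \<in> {1, -1}"
    and "primary_components_are_eigenspaces (vec_smul s) (casimir (vec_smul s) (tens_sl2_act s D))"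
  shows "primary_projection (vec_smul s) (casimir (vec_smul s) (tens_sl2_act s D)) (l + \<delta>) x =
    vec_smul s (1 / (2 * \<delta> * l)) (twist x + vec_smul s (1 + \<delta> * l) x)"
proof -
  interpret W: vector_space "vec_smul s" by (rule vector_space_pairs)
  let ?s = "vec_smul s" and ?\<Omega> = "casimir (vec_smul s) (tens_sl2_act s D)"
  have \<delta>: "\<delta> * \<delta> = 1" "\<delta> \<noteq> 0" using assms(2) by auto
  define a where "a = (l + \<delta>)\<^sup>2 - 1"
  define b where "b = (l - \<delta>)\<^sup>2 - 1"
  have a: "a = l\<^sup>2 + 2 * \<delta> * l" and b: "b = l\<^sup>2 - 2 * \<delta> * l"
    using \<delta> by (simp_all add: a_def b_def power2_eq_square algebra_simps)
  have ab: "a - b = 4 * \<delta> * l" by (simp add: a b)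
  have "a \<noteq> b" using ab assms(1) \<delta> by auto
  have twist: "twist (?s c x + ?s d y) = ?s c (twist x) + ?s d (twist y)" for c d x y
    using twist_linear by (simp add: clinear_def)
  have lin: "clinear ?s ?s ?\<Omega>"
    using twist_linear by (simp add: clinear_def tensor_casimir W.scale_right_distrib mult.commute
        add.assoc add.left_commute)
  have quad: "?\<Omega> (?\<Omega> w) = ?s (a + b) (?\<Omega> w) - ?s (a * b) w" for w
  proof -
    let ?t = "twist w"
    define q r where "q = l\<^sup>2 + 2" and "r = l\<^sup>2 - 1"
    have "?\<Omega> (?\<Omega> w) = ?s q (?s q w + ?s 2 ?t) + ?s 2 (?s q ?t + ?s 2 (?s r w - ?s 2 ?t))"
      by (simp only: tensor_casimir twist twist_twist q_def r_def)
    also have "\<dots> = ?s (q * q + 2 * (2 * r)) w + ?s (q * 2 + 2 * q - 2 * (2 * 2)) ?t"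
      by (simp only: W.scale_right_distrib W.scale_right_diff_distrib W.scale_left_distrib
          W.scale_left_diff_distrib W.scale_scale)
        (simp only: diff_conv_add_uminus add.assoc add.commute add.left_commute)
    also have "q * q + 2 * (2 * r) = (a + b) * (l\<^sup>2 + 2) - a * b"
      unfolding a b q_def r_def using \<delta>(1) by algebra
    also have "q * 2 + 2 * q - 2 * (2 * 2) = (a + b) * 2"
      unfolding a b q_def by simp
    finally show ?thesis
      by (simp add: tensor_casimir W.scale_right_distrib W.scale_left_diff_distrib)
  qed
  have "primary_projection ?s ?\<Omega> (l + \<delta>) x = ?s (1 / (a - b)) (?\<Omega> x - ?s b x)"
    by (rule primary_projection_quadratic[OF vector_space_pairs lin quad a_def b_def \<open>a \<noteq> b\<close> assms(3)])
  also have "?\<Omega> x - ?s b x = ?s 2 (twist x + ?s (1 + \<delta> * l) x)"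
  proof -
    have "l\<^sup>2 + 2 - b = 2 * (1 + \<delta> * l)" by (simp add: b)
    then have "?s (l\<^sup>2 + 2) x - ?s b x = ?s (2 * (1 + \<delta> * l)) x"
      by (simp flip: W.scale_left_diff_distrib)
    then show ?thesis by (simp add: tensor_casimir W.scale_right_distrib algebra_simps)
  qed
  also have "?s (1 / (a - b)) (?s 2 y) = ?s (1 / (2 * \<delta> * l)) y" for y
    by (simp add: ab)
  finally show ?thesis .
qed

end

lemma (in smooth_representation) sl2_act_module:
  assumes iso: "sl2_iso G \<phi>" and "infinitesimal_character G \<phi> R l"
  shows "sl2_module (smul R) (sl2_act G \<phi> R) l"
proof
  note bracket = sl2_act_bracket[OF iso]
  show "sl2_act G \<phi> R sl2_H (sl2_act G \<phi> R sl2_X v) =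
      sl2_act G \<phi> R sl2_X (sl2_act G \<phi> R sl2_H v) + smul R 2 (sl2_act G \<phi> R sl2_X v)" for v
    by (rule bracket) (simp_all add: sl2_trace sl2_brackets)
  show "sl2_act G \<phi> R sl2_H (sl2_act G \<phi> R sl2_Y v) =
      sl2_act G \<phi> R sl2_Y (sl2_act G \<phi> R sl2_H v) - smul R 2 (sl2_act G \<phi> R sl2_Y v)" for v
    using bracket[of sl2_H sl2_Y sl2_Y "- 2" v] by (simp add: sl2_trace sl2_brackets)
  have "mat_scale 1 sl2_H = sl2_H" by (simp add: mat_scale_def vec_eq_iff)
  then show "sl2_act G \<phi> R sl2_X (sl2_act G \<phi> R sl2_Y v) =
      sl2_act G \<phi> R sl2_Y (sl2_act G \<phi> R sl2_X v) + sl2_act G \<phi> R sl2_H v" for v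
    using bracket[of sl2_X sl2_Y sl2_H 1 v] by (simp add: sl2_trace sl2_brackets)
  show "casimir (smul R) (sl2_act G \<phi> R) v = smul R (l\<^sup>2 - 1) v" for v
    using assms(2) by (simp add: infinitesimal_character_def)
qed (simp_all add: sl2_act_def cx_lie_act_add cx_lie_act_smul)

section \<open>Contracting two projections\<close>

locale sl2_bilinear =
  M1: sl2_module s1 D1 l1 + M2: sl2_module s2 D2 l2 + M3: sl2_module s3 D3 l3
  for s1 :: "complex \<Rightarrow> 'u \<Rightarrow> 'u::ab_group_add" and D1 l1
    and s2 :: "complex \<Rightarrow> 'v \<Rightarrow> 'v::ab_group_add" and D2 l2
    and s3 :: "complex \<Rightarrow> 'w \<Rightarrow> 'w::ab_group_add" and D3 l3 +
  fixes S :: "'u \<Rightarrow> 'v \<Rightarrow> 'w"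
  assumes linear1: "clinear s1 s3 (\<lambda>u. S u v)" and linear2: "clinear s2 s3 (S u)"
    and leibniz: "M \<in> {sl2_H, sl2_X, sl2_Y} \<Longrightarrow> D3 M (S u v) = S (D1 M u) v + S u (D2 M v)"
begin

lemma S_simps:
  "S (u + u') v = S u v + S u' v" "S (s1 c u) v = s3 c (S u v)" "S (u - u') v = S u v - S u' v"
  "S u (v + v') = S u v + S u v'" "S u (s2 c v) = s3 c (S u v)" "S u (v - v') = S u v - S u v'"
proof -
  have 1: "S (u + u') v = S u v + S u' v" "S u (v + v') = S u v + S u v'" for u u' v v'
    using linear1 linear2 by (simp_all add: clinear_def)
  then show "S (u + u') v = S u v + S u' v" "S u (v + v') = S u v + S u v'" by blast+
  show "S (s1 c u) v = s3 c (S u v)" "S u (s2 c v) = s3 c (S u v)"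
    using linear1 linear2 by (simp_all add: clinear_def)
  show "S (u - u') v = S u v - S u' v" using 1(1)[of "u - u'" u' v] by simp
  show "S u (v - v') = S u v - S u v'" using 1(2)[of u "v - v'" v'] by simp
qed

text \<open>Expand the Casimir element on \<open>S(u, v)\<close> by the Leibniz rule: it acts on the target and in each
  argument by a scalar, and what is left are the mixed terms.\<close>

lemma cross_terms:
  "s3 2 (S (M1.H u) (M2.H v)) + s3 4 (S (M1.X u) (M2.Y v)) + s3 4 (S (M1.Y u) (M2.X v)) =
    s3 (l3\<^sup>2 - l1\<^sup>2 - l2\<^sup>2 + 1) (S u v)"
proof -
  have 4: "s3 4 w = w + w + w + w" for w
    using M3.scale_left_distrib[of 2 2 w] by (simp add: M3.scale_2)
  have "s3 (l3\<^sup>2 - 1) (S u v) = casimir s3 D3 (S u v)" by (rule M3.casimir[symmetric])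
  also have "\<dots> = S (casimir s1 D1 u) v + S u (casimir s2 D2 v) +
      (s3 2 (S (M1.H u) (M2.H v)) + s3 4 (S (M1.X u) (M2.Y v)) + s3 4 (S (M1.Y u) (M2.X v)))"
    by (simp add: casimir_def leibniz M3.D_add S_simps M3.scale_2 4)
  also have "\<dots> = s3 (l1\<^sup>2 - 1) (S u v) + s3 (l2\<^sup>2 - 1) (S u v) +
      (s3 2 (S (M1.H u) (M2.H v)) + s3 4 (S (M1.X u) (M2.Y v)) + s3 4 (S (M1.Y u) (M2.X v)))"
    by (simp only: M1.casimir M2.casimir S_simps)
  finally have "s3 2 (S (M1.H u) (M2.H v)) + s3 4 (S (M1.X u) (M2.Y v)) + s3 4 (S (M1.Y u) (M2.X v)) =
      s3 (l3\<^sup>2 - 1) (S u v) - (s3 (l1\<^sup>2 - 1) (S u v) + s3 (l2\<^sup>2 - 1) (S u v))"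
    by simp
  also have "\<dots> = s3 ((l3\<^sup>2 - 1) - ((l1\<^sup>2 - 1) + (l2\<^sup>2 - 1))) (S u v)"
    by (simp only: M3.scale_left_diff_distrib M3.scale_left_distrib)
  also have "(l3\<^sup>2 - 1) - ((l1\<^sup>2 - 1) + (l2\<^sup>2 - 1)) = l3\<^sup>2 - l1\<^sup>2 - l2\<^sup>2 + 1" by simp
  finally show ?thesis .
qed

text \<open>Here \<open>x\<close> and \<open>y\<close> are the projections of \<open>u \<otimes> e\<close> and \<open>v \<otimes> e\<close> without the denominators. The terms that
  are linear in \<open>H\<close> cancel because the weights of \<open>e_plus\<close> and \<open>e_minus\<close> are opposite.\<close>

lemma contraction:
  fixes \<delta> \<epsilon> u v
  defines "x \<equiv> \<lambda>e. M1.twist (tens s1 u e) + vec_smul s1 (1 + \<delta> * l1) (tens s1 u e)"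
    and "y \<equiv> \<lambda>e. M2.twist (tens s2 v e) + vec_smul s2 (1 + \<epsilon> * l2) (tens s2 v e)"
  assumes "\<delta> * \<delta> = 1" "\<epsilon> * \<epsilon> = 1"
  shows "(S (x e_plus $ 1) (y e_minus $ 2) - S (x e_minus $ 1) (y e_plus $ 2)) -
      (S (x e_plus $ 2) (y e_minus $ 1) - S (x e_minus $ 2) (y e_plus $ 1)) =
    s3 ((\<delta> * l1 + \<epsilon> * l2 + 1 + l3) * (\<delta> * l1 + \<epsilon> * l2 + 1 - l3)) (S u v)"
proof -
  define a b where "a = 1 + \<delta> * l1" and "b = 1 + \<epsilon> * l2"
  have x: "x e_plus $ 1 = M1.H u + s1 a u" "x e_plus $ 2 = s1 2 (M1.X u)"
    "x e_minus $ 1 = s1 2 (M1.Y u)" "x e_minus $ 2 = s1 a u - M1.H u"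
    using M1.D_scale[of _ 0 0]
    by (simp_all add: x_def a_def tens_def e_plus_def e_minus_def axis_def vec_smul_def)
  have y: "y e_plus $ 1 = M2.H v + s2 b v" "y e_plus $ 2 = s2 2 (M2.X v)"
    "y e_minus $ 1 = s2 2 (M2.Y v)" "y e_minus $ 2 = s2 b v - M2.H v"
    using M2.D_scale[of _ 0 0]
    by (simp_all add: y_def b_def tens_def e_plus_def e_minus_def axis_def vec_smul_def)
  have 4: "s3 4 w = w + w + w + w" for w
    using M3.scale_left_distrib[of 2 2 w] by (simp add: M3.scale_2)
  have "(S (x e_plus $ 1) (y e_minus $ 2) - S (x e_minus $ 1) (y e_plus $ 2)) -
      (S (x e_plus $ 2) (y e_minus $ 1) - S (x e_minus $ 2) (y e_plus $ 1)) =
      s3 (a * b) (S u v) + s3 (a * b) (S u v) -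
      (s3 2 (S (M1.H u) (M2.H v)) + s3 4 (S (M1.X u) (M2.Y v)) + s3 4 (S (M1.Y u) (M2.X v)))"
    by (simp only: x y S_simps M1.scale_2 M2.scale_2 M3.scale_2 4 M3.scale_right_diff_distrib
        M3.scale_right_distrib M3.scale_scale mult.commute[of b a])
      (simp add: algebra_simps)
  also have "\<dots> = s3 (a * b + a * b - (l3\<^sup>2 - l1\<^sup>2 - l2\<^sup>2 + 1)) (S u v)"
    unfolding cross_terms by (simp only: M3.scale_left_diff_distrib M3.scale_left_distrib)
  also have "a * b + a * b - (l3\<^sup>2 - l1\<^sup>2 - l2\<^sup>2 + 1) =
      (\<delta> * l1 + \<epsilon> * l2 + 1 + l3) * (\<delta> * l1 + \<epsilon> * l2 + 1 - l3)"
    unfolding a_def b_def using assms(3,4) by algebra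
  finally show ?thesis .
qed

end

text \<open>The left hand side is the value of \<open>T \<otimes> pr\<close> on the projected vector, written out in coordinates:
  one half of the antisymmetrization over the two copies of \<open>\<complex>\<^sup>2\<close>. This half and the two
  denominators \<open>2 \<delta> l1\<close>, \<open>2 \<epsilon> l2\<close> make the factor \<open>8\<close>.\<close>

lemma (in sl2_bilinear) projected_contraction:
  assumes l: "l1 \<noteq> 0" "l2 \<noteq> 0" and \<delta>: "\<delta> \<in> {1, -1}" and \<epsilon>: "\<epsilon> \<in> {1, -1}"
    and eigen1: "primary_components_are_eigenspaces (vec_smul s1) (casimir (vec_smul s1) (tens_sl2_act s1 D1))"
    and eigen2: "primary_components_are_eigenspaces (vec_smul s2) (casimir (vec_smul s2) (tens_sl2_act s2 D2))"
  defines "P1 \<equiv> primary_projection (vec_smul s1) (casimir (vec_smul s1) (tens_sl2_act s1 D1)) (l1 + \<delta>)"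
    and "P2 \<equiv> primary_projection (vec_smul s2) (casimir (vec_smul s2) (tens_sl2_act s2 D2)) (l2 + \<epsilon>)"
  shows "s3 (1 / 2) (S (P1 (tens s1 u e_plus) $ 1) (P2 (tens s2 v e_minus) $ 2) -
        S (P1 (tens s1 u e_minus) $ 1) (P2 (tens s2 v e_plus) $ 2)) +
      s3 (- (1 / 2)) (S (P1 (tens s1 u e_plus) $ 2) (P2 (tens s2 v e_minus) $ 1) -
        S (P1 (tens s1 u e_minus) $ 2) (P2 (tens s2 v e_plus) $ 1)) =
    s3 (((\<delta> * l1 + \<epsilon> * l2 + 1 + l3) * (\<delta> * l1 + \<epsilon> * l2 + 1 - l3)) /
      (8 * (\<delta> * l1) * (\<epsilon> * l2))) (S u v)"
proof -
  define x where "x e = M1.twist (tens s1 u e) + vec_smul s1 (1 + \<delta> * l1) (tens s1 u e)" for e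
  define y where "y e = M2.twist (tens s2 v e) + vec_smul s2 (1 + \<epsilon> * l2) (tens s2 v e)" for e
  define k where "k = 1 / (2 * \<delta> * l1) * (1 / (2 * \<epsilon> * l2))"
  have P1: "P1 (tens s1 u e) $ i = s1 (1 / (2 * \<delta> * l1)) (x e $ i)" for e i
    unfolding P1_def x_def M1.tensor_primary_projection[OF l(1) \<delta> eigen1] by (simp add: vec_smul_def)
  have P2: "P2 (tens s2 v e) $ i = s2 (1 / (2 * \<epsilon> * l2)) (y e $ i)" for e i
    unfolding P2_def y_def M2.tensor_primary_projection[OF l(2) \<epsilon> eigen2] by (simp add: vec_smul_def)
  have SP: "S (P1 (tens s1 u e) $ i) (P2 (tens s2 v f) $ j) = s3 k (S (x e $ i) (y f $ j))" for e f i j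
    by (simp add: P1 P2 S_simps k_def)
  have half: "s3 (1 / 2) (s3 k a - s3 k b) + s3 (- (1 / 2)) (s3 k c - s3 k d) =
      s3 (k / 2) ((a - b) - (c - d))" for a b c d
    by (simp add: M3.scale_right_diff_distrib mult.commute)
  have "\<delta> * \<delta> = 1" "\<epsilon> * \<epsilon> = 1" using \<delta> \<epsilon> by auto
  from contraction[OF this, of u v, folded x_def y_def]
  show ?thesis
    unfolding SP half by (simp add: k_def mult_ac)
qed

section \<open>Rationality of the coefficients\<close>

lemma poly3_simps:
  "poly3 (P + Q) x y z = poly3 P x y z + poly3 Q x y z"
  "poly3 (P - Q) x y z = poly3 P x y z - poly3 Q x y z"
  "poly3 (P * Q) x y z = poly3 P x y z * poly3 Q x y z"
  "poly3 1 x y z = 1"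
  "poly3 [:[:[:c:]:]:] x y z = c"
  "poly3 [:[:[:0, 1:]:]:] x y z = x"
  "poly3 [:[:0, 1:]:] x y z = y"
  "poly3 [:0, 1:] x y z = z"
  by (simp_all add: poly3_def)

text \<open>In \<^const>\<open>poly3\<close> the innermost polynomial variable is the first argument, the outermost the third.\<close>

lemma rational_coefficient:
  assumes "\<delta> \<in> {1, -1}" "\<epsilon> \<in> {1, -1}"
  shows "rational_function3 (\<lambda>l1 l2 l3.
    ((\<delta> * l1 + \<epsilon> * l2 + 1 + l3) * (\<delta> * l1 + \<epsilon> * l2 + 1 - l3)) / (8 * (\<delta> * l1) * (\<epsilon> * l2)))"
proof -
  define k :: "complex \<Rightarrow> complex poly poly poly" where "k c = [:[:[:c:]:]:]" for c
  define x y z :: "complex poly poly poly"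
    where "x = [:[:[:0, 1:]:]:]" and "y = [:[:0, 1:]:]" and "z = [:0, 1:]"
  have "k 8 * (k \<delta> * x) * (k \<epsilon> * y) \<noteq> 0"
    using assms by (auto simp: k_def x_def y_def)
  moreover have "poly3 (k c) = (\<lambda>x y z. c)" for c
    by (intro ext) (simp add: k_def poly3_simps)
  moreover have "poly3 x = (\<lambda>x y z. x)" "poly3 y = (\<lambda>x y z. y)" "poly3 z = (\<lambda>x y z. z)"
    by (intro ext, simp add: x_def y_def z_def poly3_simps)+
  ultimately show ?thesis
    unfolding rational_function3_def
    by (intro exI[of _ "(k \<delta> * x + k \<epsilon> * y + 1 + z) * (k \<delta> * x + k \<epsilon> * y + 1 - z)"]
        exI[of _ "k 8 * (k \<delta> * x) * (k \<epsilon> * y)"]) (simp add: poly3_simps)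
qed

section \<open>Symmetry breaking operators\<close>

lemma T_tensor_pr_F_eq:
  assumes "vector_space s"
  shows "T_tensor_pr_F s T z = s (1 / 2) (T (z $ 1 $ 2)) + s (- (1 / 2)) (T (z $ 2 $ 1))"
proof -
  interpret vector_space s by (rule assms)
  show ?thesis by (simp add: T_tensor_pr_F_def pr_F_def sum_2 axis_def)
qed

theorem theorem3p1:
  shows "\<exists>c :: complex \<Rightarrow> complex \<Rightarrow> complex \<Rightarrow> complex \<Rightarrow> complex \<Rightarrow> complex.
    (\<forall>\<delta>\<in>{1, -1}. \<forall>\<epsilon>\<in>{1, -1}. rational_function3 (c \<delta> \<epsilon>)) \<and>
    (\<forall>\<delta>\<in>{1, -1}. \<forall>\<epsilon>\<in>{1, -1}. \<forall>l1 l2 l3. l1 \<noteq> 0 \<longrightarrow> l2 \<noteq> 0 \<longrightarrow>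
       c \<delta> \<epsilon> l1 l2 l3 =
         ((\<delta> * l1 + \<epsilon> * l2 + 1 + l3) * (\<delta> * l1 + \<epsilon> * l2 + 1 - l3)) / (8 * (\<delta> * l1) * (\<epsilon> * l2))) \<and>
    (\<forall>(G :: ('g::t2_space, 'm::euclidean_space) charted_group) (p :: 'g \<Rightarrow> real^'n^'n) \<phi>
      (R1 :: ('g, 'v1::{t2_space,ab_group_add}) representation)
      (R2 :: ('g, 'v2::{t2_space,ab_group_add}) representation)
      (R3 :: ('g, 'v3::{t2_space,ab_group_add}) representation)
      (E :: ('g \<times> 'g, 'e::{t2_space,ab_group_add}) representation)
      (t :: 'v1 \<Rightarrow> 'v2 \<Rightarrow> 'e) (T :: 'e \<Rightarrow> 'v3) l1 l2 l3.
       real_reductive_group G p \<longrightarrow> sl2_iso G \<phi> \<longrightarrow>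
       in_category_M G p R1 \<longrightarrow> in_category_M G p R2 \<longrightarrow> in_category_M G p R3 \<longrightarrow>
       infinitesimal_character G \<phi> R1 l1 \<longrightarrow> infinitesimal_character G \<phi> R2 l2 \<longrightarrow>
       infinitesimal_character G \<phi> R3 l3 \<longrightarrow>
       l1 \<noteq> 0 \<longrightarrow> l2 \<noteq> 0 \<longrightarrow>
       primary_components_are_eigenspaces (vec_smul (smul R1)) (tens_casimir G \<phi> R1) \<longrightarrow>
       primary_components_are_eigenspaces (vec_smul (smul R2)) (tens_casimir G \<phi> R2) \<longrightarrow>
       outer_tensor_product R1 R2 E t \<longrightarrow>
       symmetry_breaking_operator E R3 T \<longrightarrow>
       (\<forall>\<delta>\<in>{1, -1}. \<forall>\<epsilon>\<in>{1, -1}. \<forall>pr.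
          outer_tensor_map (smul E) t
            (tens_projection G \<phi> R1 (l1 + \<delta>)) (tens_projection G \<phi> R2 (l2 + \<epsilon>)) pr \<longrightarrow>
          (\<forall>u v. T_tensor_pr_F (smul R3) T (pr (H_vector R1 R2 t u v)) =
                 smul R3 (c \<delta> \<epsilon> l1 l2 l3) (T (t u v)))))"

proof -
  define c :: "complex \<Rightarrow> complex \<Rightarrow> complex \<Rightarrow> complex \<Rightarrow> complex \<Rightarrow> complex" where
    "c \<delta> \<epsilon> l1 l2 l3 =
      ((\<delta> * l1 + \<epsilon> * l2 + 1 + l3) * (\<delta> * l1 + \<epsilon> * l2 + 1 - l3)) / (8 * (\<delta> * l1) * (\<epsilon> * l2))"
    for \<delta> \<epsilon> l1 l2 l3
  have rational: "rational_function3 (c \<delta> \<epsilon>)" if "\<delta> \<in> {1, -1}" "\<epsilon> \<in> {1, -1}" for \<delta> \<epsilon>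
    using rational_coefficient[OF that] by (simp add: c_def[abs_def])
  have main: "T_tensor_pr_F (smul R3) T (pr (H_vector R1 R2 t u v)) = smul R3 (c \<delta> \<epsilon> l1 l2 l3) (T (t u v))"
    if G: "real_reductive_group G p" and iso: "sl2_iso G \<phi>"
      and M: "in_category_M G p R1" "in_category_M G p R2" "in_category_M G p R3"
      and inf: "infinitesimal_character G \<phi> R1 l1" "infinitesimal_character G \<phi> R2 l2"
        "infinitesimal_character G \<phi> R3 l3"
      and l: "l1 \<noteq> 0" "l2 \<noteq> 0"
      and eigen: "primary_components_are_eigenspaces (vec_smul (smul R1)) (tens_casimir G \<phi> R1)"
        "primary_components_are_eigenspaces (vec_smul (smul R2)) (tens_casimir G \<phi> R2)"
      and E: "outer_tensor_product R1 R2 E t" and T: "symmetry_breaking_operator E R3 T"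
      and sgn: "\<delta> \<in> {1, -1}" "\<epsilon> \<in> {1, -1}"
      and pr: "outer_tensor_map (smul E) t
        (tens_projection G \<phi> R1 (l1 + \<delta>)) (tens_projection G \<phi> R2 (l2 + \<epsilon>)) pr"
    for G :: "('g, 'm) charted_group" and p :: "'g \<Rightarrow> real^'n^'n" and \<phi>
      and R1 :: "('g, 'v1) representation" and R2 :: "('g, 'v2) representation"
      and R3 :: "('g, 'v3) representation" and E :: "('g \<times> 'g, 'e) representation"
      and t T l1 l2 l3 \<delta> \<epsilon> pr u v
  proof -
    have lie: "lie_group G" using G by (simp add: real_reductive_group_def)
    have rep: "smooth_frechet_rep G R1" "smooth_frechet_rep G R2" "smooth_frechet_rep G R3"
      using M by (simp_all add: in_category_M_def)
    obtain p1 p2 p3 where smooth: "smooth_representation G R1 p1" "smooth_representation G R2 p2"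
        "smooth_representation G R3 p3"
      using rep[THEN smooth_representation_exists[OF lie]] by (elim exE) (rule that)
    interpret R1: smooth_representation G R1 p1 by (rule smooth(1))
    interpret R2: smooth_representation G R2 p2 by (rule smooth(2))
    interpret R3: smooth_representation G R3 p3 by (rule smooth(3))
    define S where "S u v = T (t u v)" for u v
    have T_add: "T (x + y) = T x + T y" and T_smul: "T (smul E d x) = smul R3 d (T x)" for x y d
      using T by (simp_all add: symmetry_breaking_operator_def clinear_def)
    have T_diff: "T (x - y) = T x - T y" for x y using T_add[of "x - y" y] by simp
    have ten: "completed_tensor_product (smul R1) (smul R2) (smul E) t"
      and ten_act: "\<And>g h u v. act E (g, h) (t u v) = t (act R1 g u) (act R2 h v)"
      using E by (simp_all add: outer_tensor_product_def)
    interpret S: equivariant_bilinear G R1 p1 R2 p2 R3 p3 S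
    proof
      show "clinear (smul R1) (smul R3) (\<lambda>u. S u v)" "clinear (smul R2) (smul R3) (S u)" for u v
        using ten by (simp_all add: completed_tensor_product_def clinear_def S_def T_add T_smul)
      have "continuous_on UNIV (\<lambda>(u, v). t u v)" "continuous_on UNIV T"
        using ten T by (simp_all add: completed_tensor_product_def symmetry_breaking_operator_def)
      then show "continuous_on UNIV (\<lambda>(u, v). S u v)"
        using continuous_on_compose2[of UNIV T UNIV "\<lambda>(u, v). t u v"]
        by (simp add: S_def case_prod_beta)
      show "act R3 g (S u v) = S (act R1 g u) (act R2 g v)" for g u v
        using T by (simp add: S_def symmetry_breaking_operator_def flip: ten_act)
    qed
    interpret B: sl2_bilinear "smul R1" "sl2_act G \<phi> R1" l1 "smul R2" "sl2_act G \<phi> R2" l2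
      "smul R3" "sl2_act G \<phi> R3" l3 S
    proof (intro sl2_bilinear.intro sl2_bilinear_axioms.intro)
      show "sl2_module (smul R1) (sl2_act G \<phi> R1) l1" by (rule R1.sl2_act_module[OF iso inf(1)])
      show "sl2_module (smul R2) (sl2_act G \<phi> R2) l2" by (rule R2.sl2_act_module[OF iso inf(2)])
      show "sl2_module (smul R3) (sl2_act G \<phi> R3) l3" by (rule R3.sl2_act_module[OF iso inf(3)])
    qed (rule S.linear1, rule S.linear2, rule S.sl2_act_leibniz)
    let ?P1 = "tens_projection G \<phi> R1 (l1 + \<delta>)" and ?P2 = "tens_projection G \<phi> R2 (l2 + \<epsilon>)"
    let ?u = "tens (smul R1) u" and ?v = "tens (smul R2) v"
    have pr_add: "pr (x + y) = pr x + pr y" and pr_tens: "pr (outer_tens t a b) = outer_tens t (?P1 a) (?P2 b)" for x y a b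
      using pr by (simp_all add: outer_tensor_map_def clinear_def)
    have "pr (x - y) = pr x - pr y" for x y using pr_add[of "x - y" y] by simp
    then have "pr (H_vector R1 R2 t u v) =
        outer_tens t (?P1 (?u e_plus)) (?P2 (?v e_minus)) - outer_tens t (?P1 (?u e_minus)) (?P2 (?v e_plus))"
      by (simp add: H_vector_def pr_tens)
    then have "T_tensor_pr_F (smul R3) T (pr (H_vector R1 R2 t u v)) =
        smul R3 (1 / 2) (S (?P1 (?u e_plus) $ 1) (?P2 (?v e_minus) $ 2) -
          S (?P1 (?u e_minus) $ 1) (?P2 (?v e_plus) $ 2)) +
        smul R3 (- (1 / 2)) (S (?P1 (?u e_plus) $ 2) (?P2 (?v e_minus) $ 1) -
          S (?P1 (?u e_minus) $ 2) (?P2 (?v e_plus) $ 1))"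
      by (simp only: T_tensor_pr_F_eq[OF R3.C.vector_space_axioms])
        (simp add: outer_tens_def T_diff S_def)
    also have "\<dots> = smul R3 (c \<delta> \<epsilon> l1 l2 l3) (S u v)"
      unfolding tens_projection_def tens_casimir_def c_def
      by (rule B.projected_contraction[OF l sgn eigen[unfolded tens_casimir_def]])
    finally show ?thesis by (simp add: S_def)
  qed
  show ?thesis
    by (intro exI[of _ c] conjI ballI allI impI rational main; (assumption | simp add: c_def))
qed

end
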